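(* Let $(M,g)$, $f$, $\Gamma$, $\psi$, $\tau$, $\alpha$, $\underline u$, $\Lambda_1$, the exhaustion $\{M_k\}_{k\ge 1}$ of $M$ and the admissible solutions $u_k$ of the approximate Dirichlet problems on $M_k$ be as described in the context. Then for every $k$, $$u_k\ge\underline u+\tfrac12\min\{0,\log\Lambda_1\}\quad\text{in } M_k.$$
   Context: $(M,g)$ is a complete noncompact Riemannian manifold of dimension $n\ge3$, and $0<\psi\in C^\infty(M)$. For a Riemannian metric $g$, $A_g^{\tau,\alpha}=\frac{\alpha}{n-2}\left(Ric_g-\frac{\tau R_g}{2(n-1)}g\right)$, where $Ric_g,R_g$ are the Ricci and scalar curvatures. For a symmetric $(0,2)$-tensor $T$, $\lambda(g^{-1}T)$ denotes the eigenvalues of $T$ with respect to $g$. $\Gamma\subset\mathbb R^n$ is an open, symmetric, convex cone with vertex at the origin, $\partial\Gamma\ne\emptyset$, $\Gamma_n\subseteq\Gamma\subset\Gamma_1$, where $\Gamma_k=\{\lambda\in\mathbb R^n:\sigma_j(\lambda)>0,\ \forall 1\le j\le k\}$ and $\sigma_j$ is the $j$-th elementary symmetric function. $f:\Gamma\to\mathbb R$ is a smooth symmetric function such that: (i) $f_i:=\partial f/\partial\lambda_i>0$ in $\Gamma$ for $1\le i\le n$; (ii) $f$ is concave in $\Gamma$; (iii) $f(t\lambda)=tf(\lambda)$ for all $\lambda\in\Gamma$, $t>0$; and, by standing assumption, $f>0$ in $\Gamma$, $f\equiv0$ on $\partial\Gamma$ (continuous extension) and $f(1,\dots,1)=1$.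 $\kappa_\Gamma$ is the largest integer $k$ such that $(-\alpha_1,\dots,-\alpha_k,\alpha_{k+1},\dots,\alpha_n)\in\Gamma$ for some $\alpha_1,\dots,\alpha_n>0$. $\vartheta_\Gamma>0$ is a fixed constant depending only on $\Gamma$ (with $\vartheta_\Gamma\le 1/n$) having the following property, the existence of such a constant being known: for every smooth symmetric concave function $\phi$ on $\Gamma$ with $\phi_i>0$ for all $i$ and with $\lim_{t\to+\infty}\phi(t\lambda)>\sigma$ for all $\lambda\in\Gamma$ and $\sigma<\sup_\Gamma\phi$, one has $\phi_i(\lambda)\ge\vartheta_\Gamma\sum_{j=1}^n\phi_j(\lambda)$ for $1\le i\le\kappa_\Gamma+1$ and every $\lambda\in\Gamma$ with $\lambda_1\le\cdots\le\lambda_n$. The parameters satisfy $\alpha\in\{1,-1\}$, $\tau\in\mathbb R$, with $\tau<1$ if $\alpha=-1$, and $\tau>1+(n-2)(1-\kappa_\Gamma\vartheta_\Gamma)$ if $\alpha=1$. $\underline g=e^{2\underline u}g$ with $\underline u\in C^\infty(M)$ is a complete metric with $\lambda(\underline g^{-1}A_{\underline g}^{\tau,\alpha})\in\Gamma$ in $M$, and $\Lambda_1>0$ is a constant such that $$f(\lambda(g^{-1}A_{\underline g}^{\tau,\alpha}))\ge\Lambda_1\psi e^{2\underline u}\quad\text{in } M.$$ $\{M_k\}_{k=1}^\infty$ is an exhaustion of $M$: $M=\bigcup_k M_k$, $\bar M_k=M_k\cup\partial M_k$ is a compact $n$-manifold with smooth boundary, and $\bar M_k\subset\subset M_{k+1}$.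 For each $k$, $u_k$ is the unique smooth solution on $\bar M_k$ of $$f(\lambda(g^{-1}A_{g_k}^{\tau,\alpha}))=\psi e^{2u_k}\ \text{ in } M_k,\quad g_k=e^{2u_k}g,\qquad u_k=\underline u\ \text{ on }\partial M_k,$$ that is admissible, i.e. $\lambda(g^{-1}A_{g_k}^{\tau,\alpha})\in\Gamma$ in $\bar M_k$ (such a solution is known to exist). *)

theory Defs
  imports "HOL-Analysis.Analysis"
begin

section \<open>Smooth functions on open subsets of Euclidean space\<close>

definition partial :: "'n::finite \<Rightarrow> (real^'n \<Rightarrow> real) \<Rightarrow> real^'n \<Rightarrow> real" where
  "partial i F x = frechet_derivative F (at x) (axis i 1)"

text \<open>Only meaningful for open \<open>S\<close>.\<close>

primrec Ck_on :: "nat \<Rightarrow> (real^'n::finite) set \<Rightarrow> (real^'n \<Rightarrow> real) \<Rightarrow> bool" where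
  "Ck_on 0 S F \<longleftrightarrow> continuous_on S F"
| "Ck_on (Suc k) S F \<longleftrightarrow> (\<forall>x\<in>S. F differentiable (at x)) \<and> (\<forall>i. Ck_on k S (partial i F))"

definition smooth_on :: "(real^'n::finite) set \<Rightarrow> (real^'n \<Rightarrow> real) \<Rightarrow> bool" where
  "smooth_on S F \<longleftrightarrow> (\<forall>k. Ck_on k S F)"

definition smooth_map_on :: "(real^'n::finite) set \<Rightarrow> (real^'n \<Rightarrow> real^'n) \<Rightarrow> bool" where
  "smooth_map_on S F \<longleftrightarrow> (\<forall>i. smooth_on S (\<lambda>x. F x $ i))"


section \<open>Smooth manifolds\<close>

text \<open>The manifold is the whole type \<open>'a\<close>; a smooth structure is given by an atlas, and a chart is
  a pair of its domain and its coordinate map (whose values off the domain are irrelevant).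
  The dimension is \<open>CARD('n)\<close>.\<close>

type_synonym ('a, 'n) chart = "'a set \<times> ('a \<Rightarrow> real^'n)"

definition chart_inv :: "('a, 'n::finite) chart \<Rightarrow> real^'n \<Rightarrow> 'a" where
  "chart_inv c = inv_into (fst c) (snd c)"

definition is_chart :: "('a::topological_space, 'n::finite) chart \<Rightarrow> bool" where
  "is_chart c \<longleftrightarrow> open (fst c) \<and> open (snd c ` fst c) \<and>
     homeomorphism (fst c) (snd c ` fst c) (snd c) (chart_inv c)"

definition compatible :: "('a, 'n::finite) chart \<Rightarrow> ('a, 'n) chart \<Rightarrow> bool" where
  "compatible c d \<longleftrightarrow>
     smooth_map_on (snd c ` (fst c \<inter> fst d)) (snd d \<circ> chart_inv c) \<and>
     smooth_map_on (snd d ` (fst c \<inter> fst d)) (snd c \<circ> chart_inv d)"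

definition smooth_atlas :: "('a::topological_space, 'n::finite) chart set \<Rightarrow> bool" where
  "smooth_atlas \<A> \<longleftrightarrow> (\<forall>c\<in>\<A>. is_chart c) \<and> (\<Union>c\<in>\<A>. fst c) = UNIV \<and>
     (\<forall>c\<in>\<A>. \<forall>d\<in>\<A>. compatible c d)"

text \<open>A chart around \<open>p\<close>, used to evaluate quantities that do not depend on the choice of chart.\<close>

definition chart_at :: "('a, 'n::finite) chart set \<Rightarrow> 'a \<Rightarrow> ('a, 'n) chart" where
  "chart_at \<A> p = (SOME c. c \<in> \<A> \<and> p \<in> fst c)"

definition smooth_fun_on ::
    "('a::topological_space, 'n::finite) chart set \<Rightarrow> 'a set \<Rightarrow> ('a \<Rightarrow> real) \<Rightarrow> bool" where
  "smooth_fun_on \<A> W u \<longleftrightarrow> open W \<and> (\<forall>c\<in>\<A>. smooth_on (snd c ` (fst c \<inter> W)) (u \<circ> chart_inv c))"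

text \<open>Smoothness on a set \<open>S\<close> that need not be open: existence of smooth local extensions.\<close>

definition smooth_ext_at ::
    "('a::topological_space, 'n::finite) chart set \<Rightarrow> 'a set \<Rightarrow> 'a \<Rightarrow> ('a \<Rightarrow> real) \<Rightarrow> ('a \<Rightarrow> real) \<Rightarrow> bool" where
  "smooth_ext_at \<A> S p u v \<longleftrightarrow>
     (\<exists>W. p \<in> W \<and> smooth_fun_on \<A> W v \<and> (\<forall>q\<in>W \<inter> S. v q = u q))"

definition smooth_up_to ::
    "('a::topological_space, 'n::finite) chart set \<Rightarrow> 'a set \<Rightarrow> ('a \<Rightarrow> real) \<Rightarrow> bool" where
  "smooth_up_to \<A> S u \<longleftrightarrow> (\<forall>p\<in>S. \<exists>v. smooth_ext_at \<A> S p u v)"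

text \<open>\<open>D\<close> is the interior of the compact, full-dimensional submanifold with smooth boundary
  \<open>closure D\<close>; near each boundary point there is a half-space chart of the smooth structure.\<close>

definition smooth_compact_domain :: "('a::topological_space, 'n::finite) chart set \<Rightarrow> 'a set \<Rightarrow> bool" where
  "smooth_compact_domain \<A> D \<longleftrightarrow> open D \<and> compact (closure D) \<and>
     (\<forall>p\<in>frontier D. \<exists>c i. is_chart c \<and> (\<forall>d\<in>\<A>. compatible c d) \<and> p \<in> fst c \<and>
        fst c \<inter> D = {q \<in> fst c. snd c q $ i > 0} \<and>
        fst c \<inter> closure D = {q \<in> fst c. snd c q $ i \<ge> 0})"


section \<open>Tensors, metrics and completeness\<close>

text \<open>A (0,2)-tensor field is the family of its component matrices \<open>T c p\<close>, one for each chart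
  \<open>c\<close> around \<open>p\<close>, related by the transformation law.\<close>

type_synonym ('a, 'n) tensor2 = "('a, 'n) chart \<Rightarrow> 'a \<Rightarrow> real^'n^'n"

definition tensor_law :: "('a, 'n::finite) chart set \<Rightarrow> ('a, 'n) tensor2 \<Rightarrow> bool" where
  "tensor_law \<A> T \<longleftrightarrow> (\<forall>c\<in>\<A>. \<forall>d\<in>\<A>. \<forall>p\<in>fst c \<inter> fst d.
     (let J = matrix (frechet_derivative (snd d \<circ> chart_inv c) (at (snd c p)))
      in T c p = transpose J ** T d p ** J))"

definition riemannian_metric ::
    "('a::topological_space, 'n::finite) chart set \<Rightarrow> ('a, 'n) tensor2 \<Rightarrow> bool" where
  "riemannian_metric \<A> g \<longleftrightarrow> tensor_law \<A> g \<and>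
     (\<forall>c\<in>\<A>. (\<forall>i j. smooth_fun_on {c} (fst c) (\<lambda>p. g c p $ i $ j)) \<and>
        (\<forall>p\<in>fst c. transpose (g c p) = g c p \<and> (\<forall>v. v \<noteq> 0 \<longrightarrow> v \<bullet> (g c p *v v) > 0)))"

text \<open>The metric \<open>e\<^sup>2\<^sup>u g\<close>.\<close>

definition conformal :: "('a \<Rightarrow> real) \<Rightarrow> ('a, 'n::finite) tensor2 \<Rightarrow> ('a, 'n) tensor2" where
  "conformal u g c p = exp (2 * u p) *\<^sub>R g c p"

definition piecewise_C1_curve ::
    "('a::topological_space, 'n::finite) chart set \<Rightarrow> (real \<Rightarrow> 'a) \<Rightarrow> bool" where
  "piecewise_C1_curve \<A> \<gamma> \<longleftrightarrow> continuous_on {0..1} \<gamma> \<and>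
     (\<exists>E. finite E \<and> (\<forall>c\<in>\<A>. (snd c \<circ> \<gamma>) C1_differentiable_on (({0..1} - E) \<inter> \<gamma> -` fst c)))"

definition speed ::
    "('a, 'n::finite) chart set \<Rightarrow> ('a, 'n) tensor2 \<Rightarrow> (real \<Rightarrow> 'a) \<Rightarrow> real \<Rightarrow> real" where
  "speed \<A> g \<gamma> t = (let c = chart_at \<A> (\<gamma> t); v = vector_derivative (snd c \<circ> \<gamma>) (at t)
     in sqrt (v \<bullet> (g c (\<gamma> t) *v v)))"

definition curve_length ::
    "('a, 'n::finite) chart set \<Rightarrow> ('a, 'n) tensor2 \<Rightarrow> (real \<Rightarrow> 'a) \<Rightarrow> ennreal" where
  "curve_length \<A> g \<gamma> = (\<integral>\<^sup>+t\<in>{0..1}. ennreal (speed \<A> g \<gamma> t) \<partial>lborel)"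

text \<open>The distance is \<open>\<infinity>\<close> between points in different components.\<close>

definition riemannian_dist ::
    "('a::topological_space, 'n::finite) chart set \<Rightarrow> ('a, 'n) tensor2 \<Rightarrow> 'a \<Rightarrow> 'a \<Rightarrow> ennreal" where
  "riemannian_dist \<A> g p q =
     (INF \<gamma>\<in>{\<gamma>. piecewise_C1_curve \<A> \<gamma> \<and> \<gamma> 0 = p \<and> \<gamma> 1 = q}. curve_length \<A> g \<gamma>)"

definition complete_metric ::
    "('a::topological_space, 'n::finite) chart set \<Rightarrow> ('a, 'n) tensor2 \<Rightarrow> bool" where
  "complete_metric \<A> g \<longleftrightarrow>
     (\<forall>X :: nat \<Rightarrow> 'a.
        (\<forall>e::real>0. \<exists>N. \<forall>m\<ge>N. \<forall>n\<ge>N. riemannian_dist \<A> g (X m) (X n) < ennreal e) \<longrightarrow>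
        (\<exists>l. X \<longlonglongrightarrow> l))"


section \<open>Curvature\<close>

text \<open>Here \<open>G\<close> is the matrix of metric coefficients as a function of the coordinates.
  \<open>christoffel G l i j\<close> has upper index \<open>l\<close>, and \<open>riemann G l i j k\<close> is the coefficient of
  \<open>\<partial>\<^sub>l\<close> in \<open>R(\<partial>\<^sub>i, \<partial>\<^sub>j)\<partial>\<^sub>k\<close>, with the sign convention making the Ricci curvature of
  round spheres positive.\<close>

definition christoffel ::
    "(real^'n::finite \<Rightarrow> real^'n^'n) \<Rightarrow> 'n \<Rightarrow> 'n \<Rightarrow> 'n \<Rightarrow> real^'n \<Rightarrow> real" where
  "christoffel G l i j x = (\<Sum>m\<in>UNIV. matrix_inv (G x) $ l $ m *
     (partial i (\<lambda>y. G y $ j $ m) x + partial j (\<lambda>y. G y $ i $ m) x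
       - partial m (\<lambda>y. G y $ i $ j) x)) / 2"

definition riemann ::
    "(real^'n::finite \<Rightarrow> real^'n^'n) \<Rightarrow> 'n \<Rightarrow> 'n \<Rightarrow> 'n \<Rightarrow> 'n \<Rightarrow> real^'n \<Rightarrow> real" where
  "riemann G l i j k x =
     partial i (christoffel G l j k) x - partial j (christoffel G l i k) x
     + (\<Sum>m\<in>UNIV. christoffel G l i m x * christoffel G m j k x
                 - christoffel G l j m x * christoffel G m i k x)"

definition ricci :: "('a, 'n::finite) tensor2 \<Rightarrow> ('a, 'n) tensor2" where
  "ricci g c p = (\<chi> j k. \<Sum>i\<in>UNIV. riemann (g c \<circ> chart_inv c) i i j k (snd c p))"

definition scalar_curv :: "('a, 'n::finite) tensor2 \<Rightarrow> ('a, 'n) chart \<Rightarrow> 'a \<Rightarrow> real" where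
  "scalar_curv g c p = (\<Sum>j\<in>UNIV. \<Sum>k\<in>UNIV. matrix_inv (g c p) $ j $ k * ricci g c p $ j $ k)"

text \<open>The modified Schouten tensor \<open>A\<^sub>g\<close> with parameters \<open>\<tau>\<close> and \<open>\<alpha>\<close>.\<close>

definition schouten :: "real \<Rightarrow> real \<Rightarrow> ('a, 'n::finite) tensor2 \<Rightarrow> ('a, 'n) tensor2" where
  "schouten \<tau> \<alpha> g c p = (\<alpha> / (real CARD('n) - 2)) *\<^sub>R
     (ricci g c p - (\<tau> * scalar_curv g c p / (2 * (real CARD('n) - 1))) *\<^sub>R g c p)"

text \<open>The eigenvalues of a matrix, listed with multiplicity in an unspecified order, when the
  characteristic polynomial splits over the reals.\<close>

definition eigvals :: "real^'n::finite^'n \<Rightarrow> real^'n" where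
  "eigvals B = (SOME l. \<forall>x. det (mat x - B) = (\<Prod>i\<in>UNIV. x - l $ i))"

text \<open>The eigenvalues \<open>\<lambda>(g\<^sup>-\<^sup>1T)\<close> at the point \<open>p\<close>.\<close>

definition eigvals_at ::
    "('a, 'n::finite) chart set \<Rightarrow> ('a, 'n) tensor2 \<Rightarrow> ('a, 'n) tensor2 \<Rightarrow> 'a \<Rightarrow> real^'n" where
  "eigvals_at \<A> g T p = (let c = chart_at \<A> p in eigvals (matrix_inv (g c p) ** T c p))"


section \<open>The cone and the symmetric function\<close>

definition elem_sym :: "nat \<Rightarrow> real^'n::finite \<Rightarrow> real" where
  "elem_sym j l = (\<Sum>S | card S = j. \<Prod>i\<in>S. l $ i)"

definition garding_cone :: "nat \<Rightarrow> (real^'n::finite) set" where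
  "garding_cone k = {l. \<forall>j. 1 \<le> j \<and> j \<le> k \<longrightarrow> elem_sym j l > 0}"

definition symmetric_cone :: "(real^'n::finite) set \<Rightarrow> bool" where
  "symmetric_cone \<Gamma> \<longleftrightarrow> open \<Gamma> \<and> convex \<Gamma> \<and>
     (\<forall>l\<in>\<Gamma>. \<forall>t::real>0. t *\<^sub>R l \<in> \<Gamma>) \<and>
     (\<forall>l\<in>\<Gamma>. \<forall>\<pi>. bij \<pi> \<longrightarrow> (\<chi> i. l $ \<pi> i) \<in> \<Gamma>) \<and>
     frontier \<Gamma> \<noteq> {} \<and>
     garding_cone CARD('n) \<subseteq> \<Gamma> \<and> \<Gamma> \<subseteq> garding_cone 1"

definition symmetric_fun :: "(real^'n::finite) set \<Rightarrow> (real^'n \<Rightarrow> real) \<Rightarrow> bool" where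
  "symmetric_fun \<Gamma> F \<longleftrightarrow> (\<forall>l\<in>\<Gamma>. \<forall>\<pi>. bij \<pi> \<longrightarrow> F (\<chi> i. l $ \<pi> i) = F l)"

definition elliptic_concave :: "(real^'n::finite) set \<Rightarrow> (real^'n \<Rightarrow> real) \<Rightarrow> bool" where
  "elliptic_concave \<Gamma> F \<longleftrightarrow> smooth_on \<Gamma> F \<and> symmetric_fun \<Gamma> F \<and> concave_on \<Gamma> F \<and>
     (\<forall>l\<in>\<Gamma>. \<forall>i. partial i F l > 0)"

definition curvature_function :: "(real^'n::finite) set \<Rightarrow> (real^'n \<Rightarrow> real) \<Rightarrow> bool" where
  "curvature_function \<Gamma> f \<longleftrightarrow> elliptic_concave \<Gamma> f \<and>
     (\<forall>l\<in>\<Gamma>. \<forall>t>0. f (t *\<^sub>R l) = t * f l) \<and>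
     (\<forall>l\<in>\<Gamma>. f l > 0) \<and> (\<forall>l\<in>frontier \<Gamma>. (f \<longlongrightarrow> 0) (at l within \<Gamma>)) \<and>
     f (\<chi> i. 1) = 1"

text \<open>The index type is linearly ordered, so that it is identified with \<open>1 < \<dots> < n\<close>;
  \<open>position i\<close> is the number in \<open>1, \<dots>, n\<close> corresponding to \<open>i\<close>.\<close>

definition position :: "'n::{finite,linorder} \<Rightarrow> nat" where
  "position i = card {..i}"

definition kappa :: "(real^'n::{finite,linorder}) set \<Rightarrow> nat" where
  "kappa \<Gamma> = Max {k. k \<le> CARD('n) \<and>
     (\<exists>a :: real^'n::{finite,linorder}. (\<forall>i. a $ i > 0) \<and> (\<chi> i. if position i \<le> k then - a $ i else a $ i) \<in> \<Gamma>)}"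

text \<open>The limit along rays and the supremum may be \<open>\<infinity>\<close>.\<close>

definition ray_limit_condition :: "(real^'n::finite) set \<Rightarrow> (real^'n \<Rightarrow> real) \<Rightarrow> bool" where
  "ray_limit_condition \<Gamma> \<phi> \<longleftrightarrow>
     (\<forall>l\<in>\<Gamma>. \<forall>\<sigma>::real. ereal \<sigma> < (SUP x\<in>\<Gamma>. ereal (\<phi> x)) \<longrightarrow>
        (\<exists>L. ((\<lambda>t. ereal (\<phi> (t *\<^sub>R l))) \<longlongrightarrow> L) at_top \<and> ereal \<sigma> < L))"

definition ellipticity_constant :: "(real^'n::{finite,linorder}) set \<Rightarrow> real \<Rightarrow> bool" where
  "ellipticity_constant \<Gamma> \<theta> \<longleftrightarrow> 0 < \<theta> \<and> \<theta> \<le> 1 / real CARD('n) \<and>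
     (\<forall>\<phi>. elliptic_concave \<Gamma> \<phi> \<longrightarrow> ray_limit_condition \<Gamma> \<phi> \<longrightarrow>
        (\<forall>l\<in>\<Gamma>. (\<forall>i j. i \<le> j \<longrightarrow> l $ i \<le> l $ j) \<longrightarrow>
           (\<forall>i. position i \<le> kappa \<Gamma> + 1 \<longrightarrow>
              partial i \<phi> l \<ge> \<theta> * (\<Sum>j\<in>UNIV. partial j \<phi> l))))"


section \<open>The Dirichlet problem\<close>

text \<open>Derivatives of \<open>u\<close> at a boundary point are those of any smooth local extension of \<open>u\<close>.\<close>

definition admissible_on ::
    "('a::topological_space, 'n::finite) chart set \<Rightarrow> ('a, 'n) tensor2 \<Rightarrow> real \<Rightarrow> real \<Rightarrow>
     (real^'n) set \<Rightarrow> 'a set \<Rightarrow> ('a \<Rightarrow> real) \<Rightarrow> bool" where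
  "admissible_on \<A> g \<tau> \<alpha> \<Gamma> S u \<longleftrightarrow>
     (\<forall>p\<in>S. \<forall>v. smooth_ext_at \<A> S p u v \<longrightarrow>
        eigvals_at \<A> g (schouten \<tau> \<alpha> (conformal v g)) p \<in> \<Gamma>)"

definition dirichlet_solution ::
    "('a::topological_space, 'n::finite) chart set \<Rightarrow> ('a, 'n) tensor2 \<Rightarrow> real \<Rightarrow> real \<Rightarrow>
     (real^'n) set \<Rightarrow> (real^'n \<Rightarrow> real) \<Rightarrow> ('a \<Rightarrow> real) \<Rightarrow> 'a set \<Rightarrow> ('a \<Rightarrow> real) \<Rightarrow>
     ('a \<Rightarrow> real) \<Rightarrow> bool" where
  "dirichlet_solution \<A> g \<tau> \<alpha> \<Gamma> f \<psi> D b u \<longleftrightarrow>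
     smooth_up_to \<A> (closure D) u \<and>
     admissible_on \<A> g \<tau> \<alpha> \<Gamma> (closure D) u \<and>
     (\<forall>p\<in>D. f (eigvals_at \<A> g (schouten \<tau> \<alpha> (conformal u g)) p) = \<psi> p * exp (2 * u p)) \<and>
     (\<forall>p\<in>frontier D. u p = b p)"

end

theory Submission
  imports Defs
begin

text \<open>
  The proof is the maximum principle. Put \<open>w = u\<^sub>k - ubar\<close> on the compact closure of \<open>M\<^sub>k\<close> and let
  \<open>q\<close> be a minimum point. If \<open>q\<close> is on the boundary then \<open>w \<ge> 0\<close> there. If \<open>q\<close> is
  interior, then \<open>dw = 0\<close> and the Hessian \<open>W\<close> of \<open>w\<close> at \<open>q\<close> is positive semidefinite, and it suffices to show that
  \<open>f\<close> of the eigenvalues of \<open>A[ubar]\<close> is at most \<open>f\<close> of the eigenvalues of \<open>A[u\<^sub>k]\<close> at \<open>q\<close>, because the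
  equation for \<open>u\<^sub>k\<close> and the differential inequality for \<open>ubar\<close> then give
  \<open>\<Lambda>\<^sub>1 exp (2 ubar) \<le> exp (2 u\<^sub>k)\<close> at \<open>q\<close>.

  Geometry (\<open>schouten_difference_at_critical_point\<close>). Regard \<open>exp (2 u\<^sub>k) g\<close> as a conformal change, with factor
  \<open>exp (2 w)\<close>, of \<open>h = exp (2 ubar) g\<close>. Since \<open>dw\<close> vanishes at \<open>q\<close>, only the terms with second derivatives of \<open>w\<close> remain in the
  transformation law, and the Ricci tensor changes by \<open>-(n-2) W - tr\<^sub>h(W) h\<close>. Hence the two Schouten tensors differ by
  \<open>\<alpha> ((\<tau>-1)/(n-2) tr\<^sub>g(W) g - W)\<close>.

  Algebra (\<open>comparison_of_eigenvalues\<close>). Diagonalize \<open>A[u\<^sub>k]\<close> relative to \<open>g\<close>, with eigenvalues \<open>b\<close>. In that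
  frame the diagonal entries of \<open>A[ubar]\<close> are \<open>P l\<close>, where \<open>l\<close> are its eigenvalues and \<open>P\<close> is doubly stochastic.
  Concavity of \<open>f\<close> bounds \<open>f(l)\<close>, in any order of the entries of \<open>l\<close>, by the tangent plane at \<open>b\<close>. For a
  symmetric concave function, larger entries of the argument have smaller partial derivatives. So for the increasing
  order of \<open>l\<close> the rearrangement inequality replaces \<open>l\<close> by \<open>P l\<close> and leaves the sum of \<open>f\<^sub>i (\<alpha> ((\<tau>-1)/(n-2) tr W - W\<^sub>i\<^sub>i))\<close> to be shown nonnegative. For \<open>\<alpha> = -1\<close> every
  summand is nonnegative because \<open>\<tau> < 1\<close>. For \<open>\<alpha> = 1\<close> the ellipticity constant gives
  \<open>f\<^sub>i \<le> (1 - \<kappa> \<theta>) (f\<^sub>1 + \<dots> + f\<^sub>n)\<close>, and \<open>1 - \<kappa> \<theta> < (\<tau>-1)/(n-2)\<close>.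
\<close>

section \<open>Diagonalizing a symmetric tensor relative to a metric\<close>

text \<open>The quadratic form \<open>x \<bullet> f x\<close> attains its maximum on the unit sphere of \<open>V\<close>, and a maximizer is an eigenvector.\<close>

lemma self_adjoint_eigenvector:
  fixes f :: "'v::euclidean_space \<Rightarrow> 'v"
  assumes f: "linear f" and sym: "\<And>x y. f x \<bullet> y = x \<bullet> f y"
    and V: "subspace V" "f ` V \<subseteq> V" "V \<noteq> {0}"
  obtains x where "x \<in> V" "norm x = 1" "f x = (x \<bullet> f x) *\<^sub>R x"
proof -
  let ?S = "sphere 0 1 \<inter> V"
  have "compact ?S"
    by (intro compact_Int_closed closed_subspace V(1)) auto
  moreover have "?S \<noteq> {}"
  proof -
    obtain v where v: "v \<in> V" "v \<noteq> 0" using V(1,3) subspace_0 by blast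
    then have "(1 / norm v) *\<^sub>R v \<in> ?S" using V(1) by (simp add: subspace_scale)
    then show ?thesis by blast
  qed
  moreover have "continuous_on ?S (\<lambda>x. x \<bullet> f x)"
    by (intro continuous_intros linear_continuous_on f linear_linear[THEN iffD2])
  ultimately obtain x where x: "x \<in> ?S" and max: "\<And>y. y \<in> ?S \<Longrightarrow> y \<bullet> f y \<le> x \<bullet> f x"
    using continuous_attains_sup by metis
  define m where "m = x \<bullet> f x"
  have xx: "x \<bullet> x = 1" using x by (simp add: dot_square_norm)
  have bound: "y \<bullet> f y \<le> m * (y \<bullet> y)" if "y \<in> V" for y
  proof (cases "y = 0")
    case False
    have "(1 / norm y) *\<^sub>R y \<in> ?S" using False that V(1) by (simp add: subspace_scale)
    from max[OF this] have "(y \<bullet> f y) / (norm y)\<^sup>2 \<le> m"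
      by (simp add: m_def linear_scale[OF f] power2_eq_square)
    then show ?thesis using False by (simp add: field_simps dot_square_norm)
  qed (simp add: linear_0[OF f])
  \<comment> \<open>First variation: along \<open>x + t y\<close> the nonnegative defect is a quadratic polynomial in \<open>t\<close>
    without constant term, so its linear coefficient vanishes.\<close>
  have "(m *\<^sub>R x - f x) \<bullet> y = 0" if y: "y \<in> V" for y
  proof (rule ccontr)
    define a where "a = (m *\<^sub>R x - f x) \<bullet> y"
    define b where "b = m * (y \<bullet> y) - y \<bullet> f y"
    have pos: "0 \<le> 2 * t * a + t\<^sup>2 * b" for t :: real
    proof -
      have "x + t *\<^sub>R y \<in> V" using x y V(1) by (simp add: subspace_add subspace_scale)
      from bound[OF this] show ?thesis
        using sym[of x y] xx
        by (simp add: a_def b_def linear_add[OF f] linear_scale[OF f] inner_simps m_def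
            power2_eq_square inner_commute algebra_simps)
    qed
    assume "(m *\<^sub>R x - f x) \<bullet> y \<noteq> 0"
    then have a: "a \<noteq> 0" by (simp add: a_def)
    have b: "b \<ge> 0" using bound[OF y] by (simp add: b_def)
    \<comment> \<open>Near \<open>t = - a / b\<close>, the minimum of the polynomial; the shift by one covers \<open>b = 0\<close>.\<close>
    have "0 \<le> 2 * (- a / (b + 1)) * a + (- a / (b + 1))\<^sup>2 * b" by (rule pos)
    also have "\<dots> = a\<^sup>2 * (- (b + 2)) / (b + 1)\<^sup>2"
      using b by (simp add: power2_eq_square divide_simps) (simp add: algebra_simps)
    also have "\<dots> < 0" using a b by (simp add: divide_neg_pos mult_pos_neg)
    finally show False by simp
  qed
  moreover have "m *\<^sub>R x - f x \<in> V"
    using x V by (auto intro!: subspace_diff subspace_scale)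
  ultimately have "(m *\<^sub>R x - f x) \<bullet> (m *\<^sub>R x - f x) = 0" by blast
  then have "f x = m *\<^sub>R x" by simp
  with x that show ?thesis by (auto simp: m_def)
qed

text \<open>Split off one eigenvector \<open>x\<close>. Self-adjointness makes the orthogonal complement of \<open>x\<close> in \<open>V\<close> invariant again.\<close>

lemma self_adjoint_eigenbasis:
  fixes f :: "'v::euclidean_space \<Rightarrow> 'v"
  assumes f: "linear f" and sym: "\<And>x y. f x \<bullet> y = x \<bullet> f y"
    and "subspace V" "f ` V \<subseteq> V"
  shows "\<exists>B. pairwise orthogonal B \<and> span B = V \<and>
    (\<forall>x\<in>B. norm x = 1 \<and> f x = (x \<bullet> f x) *\<^sub>R x)"
  using assms(3,4)
proof (induction "dim V" arbitrary: V rule: less_induct)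
  case less
  show ?case
  proof (cases "V = {0}")
    case True
    then show ?thesis by (intro exI[of _ "{}"]) auto
  next
    case False
    obtain x where x: "x \<in> V" "norm x = 1" "f x = (x \<bullet> f x) *\<^sub>R x"
      using self_adjoint_eigenvector[OF f sym less.prems False] by blast
    let ?W = "{y \<in> V. x \<bullet> y = 0}"
    have W: "subspace ?W"
      using less.prems(1) by (auto simp: subspace_def inner_simps)
    have "x \<notin> ?W" using x(2) by auto
    then have "?W \<subset> V" using x(1) by blast
    then have "dim ?W < dim V"
      using dim_psubset[of ?W V] W less.prems(1) by (simp add: span_eq_iff[THEN iffD2])
    moreover have "f ` ?W \<subseteq> ?W"
    proof -
      have "x \<bullet> f y = 0" if "x \<bullet> y = 0" for y
        using sym[of x y] x(3) that by (metis inner_scaleR_left mult_zero_right)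
      then show ?thesis using less.prems(2) by auto
    qed
    ultimately have "\<exists>B. pairwise orthogonal B \<and> span B = ?W \<and>
        (\<forall>x\<in>B. norm x = 1 \<and> f x = (x \<bullet> f x) *\<^sub>R x)"
      by (intro less.hyps[OF _ W])
    then obtain B where B: "pairwise orthogonal B" "span B = ?W"
        "\<forall>x\<in>B. norm x = 1 \<and> f x = (x \<bullet> f x) *\<^sub>R x"
      by (elim exE conjE)
    have "orthogonal x y" if "y \<in> B" for y
      using that B(2) span_base[of y B] by (auto simp: orthogonal_def)
    then have "pairwise orthogonal (insert x B)"
      using B(1) by (auto simp: pairwise_insert orthogonal_commute)
    moreover have "span (insert x B) = V"
    proof
      show "span (insert x B) \<subseteq> V"
        using x(1) B(2) span_superset[of B] less.prems(1) by (intro span_minimal) auto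
      show "V \<subseteq> span (insert x B)"
      proof
        fix y assume y: "y \<in> V"
        have "y - (x \<bullet> y) *\<^sub>R x \<in> ?W"
          using y x(1,2) less.prems(1)
          by (simp add: subspace_diff subspace_scale inner_simps dot_square_norm)
        then show "y \<in> span (insert x B)"
          unfolding B(2)[symmetric] span_breakdown_eq by blast
      qed
    qed
    ultimately show ?thesis using B(3) x(2,3) by (intro exI[of _ "insert x B"]) auto
  qed
qed

definition diagonal :: "real^'n \<Rightarrow> real^'n^'n" where
  "diagonal d = (\<chi> i j. if i = j then d $ i else 0)"

lemma diagonal_mult_left: "(diagonal d ** A) $ i $ j = d $ i * A $ i $ j"
  by (simp add: diagonal_def matrix_matrix_mult_def if_distrib[of "\<lambda>x. x * _"] cong: if_cong)

lemma diagonal_mult_right: "(A ** diagonal d) $ i $ j = A $ i $ j * d $ j"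
  by (simp add: diagonal_def matrix_matrix_mult_def if_distrib[of "\<lambda>x. _ * x"] cong: if_cong)

lemma transpose_diagonal [simp]: "transpose (diagonal d) = diagonal d"
  by (auto simp: diagonal_def transpose_def vec_eq_iff)

lemma spectral_theorem:
  fixes A :: "real^'n^'n"
  assumes A: "transpose A = A"
  obtains Q :: "real^'n^'n" and d where "transpose Q ** Q = mat 1" "transpose Q ** A ** Q = diagonal d"
proof -
  have "(A *v x) \<bullet> y = x \<bullet> (A *v y)" for x y
    by (metis A dot_lmul_matrix vector_transpose_matrix)
  then obtain B where B: "pairwise orthogonal B" "span B = UNIV"
      "\<forall>x\<in>B. norm x = 1 \<and> A *v x = (x \<bullet> (A *v x)) *\<^sub>R x"
    using self_adjoint_eigenbasis[of "(*v) A" UNIV] by auto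
  have "0 \<notin> B" using B(3) by auto
  then have ind: "independent B" using B(1) pairwise_orthogonal_independent by blast
  then have "finite B" "card B = CARD('n)"
    using independent_imp_finite B(2) dim_span_eq_card_independent[OF ind] by auto
  then obtain b :: "'n \<Rightarrow> real^'n" where b: "bij_betw b UNIV B"
    using finite_same_card_bij[of "UNIV :: 'n set" B] by auto
  have bb: "b i \<bullet> b j = (if i = j then 1 else 0)" for i j
  proof (cases "i = j")
    case True
    then show ?thesis using B(3) b by (auto simp: bij_betw_def dot_square_norm)
  next
    case False
    then have "b i \<noteq> b j" using b by (auto simp: bij_betw_def inj_on_def)
    then show ?thesis using False B(1) b by (auto simp: pairwise_def orthogonal_def bij_betw_def)
  qed
  define Q :: "real^'n^'n" where "Q = (\<chi> i j. b j $ i)"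
  define d :: "real^'n" where "d = (\<chi> j. b j \<bullet> (A *v b j))"
  have eig: "A *v b j = d $ j *\<^sub>R b j" for j
    using B(3) b by (auto simp: d_def bij_betw_def)
  have QQ: "transpose Q ** Q = mat 1"
    using bb by (simp add: vec_eq_iff Q_def transpose_def matrix_matrix_mult_def mat_def inner_vec_def)
  have "A ** Q = Q ** diagonal d"
    using eig by (simp add: vec_eq_iff diagonal_mult_right) 
     (simp add: Q_def matrix_matrix_mult_def matrix_vector_mult_def mult.commute)
  then have "transpose Q ** A ** Q = diagonal d"
    by (metis QQ matrix_mul_assoc matrix_mul_lid)
  with QQ that show ?thesis by blast
qed

text \<open>First a frame \<open>S\<close> in which \<open>G\<close> is the identity, then an orthogonal change of frame, which keeps \<open>G\<close> and
  diagonalizes the tensor \<open>T\<close> transported to \<open>S\<close>.\<close>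

lemma simultaneous_diagonalization:
  fixes G T :: "real^'n^'n"
  assumes G: "transpose G = G" "\<And>v. v \<noteq> 0 \<Longrightarrow> v \<bullet> (G *v v) > 0" and T: "transpose T = T"
  obtains Q :: "real^'n^'n" and d where "transpose Q ** G ** Q = mat 1" "transpose Q ** T ** Q = diagonal d"
proof -
  obtain P :: "real^'n^'n" and e where P: "transpose P ** P = mat 1" "transpose P ** G ** P = diagonal e"
    using spectral_theorem[OF G(1)] by blast
  have e: "e $ i > 0" for i
  proof -
    have "P *v axis i 1 \<noteq> 0"
    proof
      assume "P *v axis i 1 = 0"
      then have "transpose P *v (P *v axis i 1) = 0" by simp
      then show False using P(1) by (simp add: matrix_vector_mul_assoc axis_eq_0_iff)
    qed
    from G(2)[OF this] have "axis i 1 \<bullet> ((transpose P ** G ** P) *v axis i 1) > 0"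
      by (metis dot_lmul_matrix matrix_vector_mul_assoc vector_transpose_matrix transpose_transpose)
    then show ?thesis unfolding P(2)
      by (simp add: matrix_vector_mult_basis column_def inner_axis' diagonal_def)
  qed
  \<comment> \<open>Rescaling the eigenvectors of \<open>G\<close> to unit \<open>G\<close>-length.\<close>
  define s :: "real^'n" where "s = (\<chi> i. 1 / sqrt (e $ i))"
  define S where "S = P ** diagonal s"
  have S: "transpose S ** G ** S = mat 1"
  proof -
    have "transpose S ** G ** S = diagonal s ** (transpose P ** G ** P) ** diagonal s"
      by (simp add: S_def matrix_transpose_mul matrix_mul_assoc)
    also have "\<dots> = mat 1"
      unfolding P(2) using e
      by (simp add: vec_eq_iff diagonal_mult_left diagonal_mult_right)
        (auto simp: diagonal_def mat_def s_def real_div_sqrt less_imp_le less_imp_neq[THEN not_sym])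
    finally show ?thesis .
  qed
  have "transpose (transpose S ** T ** S) = transpose S ** T ** S"
    by (simp add: matrix_transpose_mul T matrix_mul_assoc)
  then obtain R :: "real^'n^'n" and d where R: "transpose R ** R = mat 1"
      "transpose R ** (transpose S ** T ** S) ** R = diagonal d"
    using spectral_theorem by blast
  have "transpose (S ** R) ** G ** (S ** R) = transpose R ** (transpose S ** G ** S) ** R"
    "transpose (S ** R) ** T ** (S ** R) = transpose R ** (transpose S ** T ** S) ** R"
    by (simp_all add: matrix_transpose_mul matrix_mul_assoc)
  then show ?thesis using that[of "S ** R" d] R S by simp
qed

lemma det_diagonal_pencil: "det (mat x - diagonal (d :: real^'n)) = (\<Prod>i\<in>UNIV. x - d $ i)"
  by (subst det_diagonal) (auto simp: diagonal_def mat_def)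

lemma matrix_diff_ldistrib: "A ** (B - C) = A ** B - A ** (C :: real^'n^'m)"
  by (simp add: vec_eq_iff matrix_matrix_mult_def sum_subtractf right_diff_distrib)

lemma matrix_diff_rdistrib: "(A - B) ** C = A ** C - B ** (C :: real^'n^'m)"
  by (simp add: vec_eq_iff matrix_matrix_mult_def sum_subtractf left_diff_distrib)

text \<open>The vector of eigenvalues is selected only up to order by the characteristic polynomial. Equal products of linear factors
  have the same multiset of roots, so any two selections differ by a permutation.\<close>

lemma eigvals_similar_diagonal:
  fixes A P Q :: "real^'n^'n"
  assumes P: "P ** Q = mat 1" and A: "A = Q ** diagonal d ** P"
  shows "\<exists>\<pi>. bij \<pi> \<and> eigvals A = (\<chi> i. (d :: real^'n) $ \<pi> i)"
proof -
  have QP: "Q ** P = mat 1" using P matrix_left_right_inverse by blast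
  have char: "det (mat x - A) = (\<Prod>i\<in>UNIV. x - d $ i)" for x
  proof -
    have "mat x = Q ** mat x ** P"
    proof -
      have "mat x = x *\<^sub>R (mat 1 :: real^'n^'n)" by (simp add: vec_eq_iff mat_def)
      then have "Q ** mat x ** P = x *\<^sub>R (Q ** P)"
        by (simp add: vec_eq_iff matrix_matrix_mult_def sum_distrib_left mat_def
            if_distrib[of "\<lambda>x. _ * x"] mult_ac cong: if_cong)
      with \<open>mat x = x *\<^sub>R mat 1\<close> show ?thesis using QP by simp
    qed
    then have "mat x - A = Q ** (mat x - diagonal d) ** P"
      unfolding A by (simp add: matrix_diff_ldistrib matrix_diff_rdistrib)
    then have "det (mat x - A) = det (Q ** P) * det (mat x - diagonal d)"
      by (simp add: det_mul)
    then show ?thesis by (simp add: QP det_diagonal_pencil)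
  qed
  define l where "l = eigvals A"
  have "\<forall>x. det (mat x - A) = (\<Prod>i\<in>UNIV. x - l $ i)"
    unfolding l_def eigvals_def by (rule someI[of _ d]) (simp add: char)
  then have "poly (\<Prod>i\<in>UNIV. [:- l $ i, 1:]) = poly (\<Prod>i\<in>UNIV. [:- d $ i, 1:])"
    using char by (simp add: fun_eq_iff poly_prod)
  then have "proots (\<Prod>i\<in>UNIV. [:- l $ i, 1:]) = proots (\<Prod>i\<in>UNIV. [:- d $ i, 1:])"
    by (simp add: poly_eq_poly_eq_iff)
  then have "(\<Sum>i\<in>UNIV. {#l $ i#}) = (\<Sum>i\<in>UNIV. {#d $ i#})"
    by (simp add: proots_prod)
  moreover have "(\<Sum>i\<in>UNIV. {#h i#}) = image_mset h (mset_set UNIV)" for h :: "'n \<Rightarrow> real"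
    by (simp add: sum_unfold_sum_mset)
  ultimately have "image_mset (($) l) (mset_set UNIV) = image_mset (($) d) (mset_set UNIV)"
    by simp
  from image_mset_eq_implies_permutes[OF _ this]
  obtain p where "p permutes UNIV" "\<forall>i. l $ i = d $ p i" by auto
  then show ?thesis unfolding l_def
    by (intro exI[of _ p]) (auto simp: vec_eq_iff permutes_bij)
qed

lemma matrix_inv_unique:
  fixes A B :: "real^'n^'n"
  assumes "A ** B = mat 1"
  shows "matrix_inv A = B"
proof -
  have BA: "B ** A = mat 1" using assms matrix_left_right_inverse by blast
  have "A ** matrix_inv A = mat 1 \<and> matrix_inv A ** A = mat 1"
    unfolding matrix_inv_def by (rule someI[of _ B]) (simp add: assms BA)
  then show ?thesis by (metis BA matrix_mul_assoc matrix_mul_lid matrix_mul_rid)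
qed

lemma congruence_to_identity:
  fixes G Q :: "real^'n^'n"
  assumes "transpose Q ** G ** Q = mat 1"
  shows "matrix_inv G = Q ** transpose Q" "(transpose Q ** G) ** Q = mat 1"
    "Q ** (transpose Q ** G) = mat 1" "(G ** Q) ** transpose Q = mat 1"
proof -
  show 1: "(transpose Q ** G) ** Q = mat 1" using assms by simp
  then show 2: "Q ** (transpose Q ** G) = mat 1" using matrix_left_right_inverse by blast
  have "transpose Q ** (G ** Q) = mat 1" using 1 by (simp add: matrix_mul_assoc)
  then show 3: "(G ** Q) ** transpose Q = mat 1" using matrix_left_right_inverse by blast
  show "matrix_inv G = Q ** transpose Q"
    by (rule matrix_inv_unique) (use 3 in \<open>simp add: matrix_mul_assoc\<close>)
qed

lemma eigvals_pencil:
  fixes G T Q :: "real^'n^'n"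
  assumes Q: "transpose Q ** G ** Q = mat 1" and T: "transpose Q ** T ** Q = diagonal d"
  shows "\<exists>\<pi>. bij \<pi> \<and> eigvals (matrix_inv G ** T) = (\<chi> i. (d :: real^'n) $ \<pi> i)"
proof (rule eigvals_similar_diagonal)
  show "(transpose Q ** G) ** Q = mat 1" using Q .
  show "matrix_inv G ** T = Q ** diagonal d ** (transpose Q ** G)"
    using congruence_to_identity[OF Q] unfolding T[symmetric]
    by (metis matrix_mul_assoc matrix_mul_rid)
qed

lemma congruence_diagonal_entry:
  fixes Q K :: "real^'n^'n"
  shows "(transpose Q ** K ** Q) $ a $ a = (\<Sum>i\<in>UNIV. \<Sum>j\<in>UNIV. Q $ i $ a * Q $ j $ a * K $ i $ j)"
  by (subst sum.swap) (simp add: matrix_matrix_mult_def transpose_def sum_distrib_left sum_distrib_right mult_ac)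

text \<open>The columns of \<open>Q\<close> form an orthonormal frame for \<open>G\<close>, and a trace relative to \<open>G\<close> is a sum over such a frame.\<close>

lemma congruence_trace:
  fixes G Q K :: "real^'n^'n"
  assumes "transpose Q ** G ** Q = mat 1"
  shows "(\<Sum>i\<in>UNIV. \<Sum>j\<in>UNIV. matrix_inv G $ i $ j * K $ i $ j) = (\<Sum>a\<in>UNIV. (transpose Q ** K ** Q) $ a $ a)"
proof -
  have "(\<Sum>i\<in>UNIV. \<Sum>j\<in>UNIV. matrix_inv G $ i $ j * K $ i $ j)
      = (\<Sum>i\<in>UNIV. \<Sum>j\<in>UNIV. \<Sum>a\<in>UNIV. Q $ i $ a * Q $ j $ a * K $ i $ j)"
    by (simp add: congruence_to_identity(1)[OF assms] matrix_matrix_mult_def transpose_def sum_distrib_right)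
  also have "\<dots> = (\<Sum>i\<in>UNIV. \<Sum>a\<in>UNIV. \<Sum>j\<in>UNIV. Q $ i $ a * Q $ j $ a * K $ i $ j)"
    by (intro sum.cong refl sum.swap)
  also have "\<dots> = (\<Sum>a\<in>UNIV. \<Sum>i\<in>UNIV. \<Sum>j\<in>UNIV. Q $ i $ a * Q $ j $ a * K $ i $ j)"
    by (rule sum.swap)
  finally show ?thesis by (simp only: congruence_diagonal_entry)
qed

text \<open>Two frames that are orthonormal for \<open>G\<close> are related by an orthogonal matrix \<open>R\<close>. Hence the diagonal of \<open>T\<close> in one
  frame is a combination of its eigenvalues with the weights \<open>R\<^sub>j\<^sub>i\<^sup>2\<close>, which are doubly stochastic.\<close>

lemma diagonal_in_other_frame:
  fixes G T Q Q' :: "real^'n^'n"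
  assumes Q: "transpose Q ** G ** Q = mat 1" and Q': "transpose Q' ** G ** Q' = mat 1"
    and T: "transpose Q' ** T ** Q' = diagonal l"
  obtains P :: "'n \<Rightarrow> 'n \<Rightarrow> real" where "\<And>i j. P i j \<ge> 0" "\<And>i. (\<Sum>j\<in>UNIV. P i j) = 1"
    "\<And>j. (\<Sum>i\<in>UNIV. P i j) = 1"
    "\<And>i. (transpose Q ** T ** Q) $ i $ i = (\<Sum>j\<in>UNIV. P i j * l $ j)"
proof -
  define R where "R = transpose Q' ** G ** Q"
  have QR: "Q = Q' ** R"
    using congruence_to_identity(3)[OF Q'] by (simp add: R_def matrix_mul_assoc)
  have "transpose R ** R = transpose R ** (transpose Q' ** G ** Q') ** R" by (simp add: Q')
  also have "\<dots> = transpose Q ** G ** Q"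
    by (simp add: QR matrix_transpose_mul matrix_mul_assoc)
  finally have RR: "transpose R ** R = mat 1" using Q by simp
  then have RR': "R ** transpose R = mat 1" using matrix_left_right_inverse by blast
  have "transpose Q ** T ** Q = transpose R ** (transpose Q' ** T ** Q') ** R"
    by (simp add: QR matrix_transpose_mul matrix_mul_assoc)
  then have D: "transpose Q ** T ** Q = transpose R ** diagonal l ** R" by (simp add: T)
  show ?thesis
  proof (rule that[of "\<lambda>i j. (R $ j $ i)\<^sup>2"])
    have "(transpose R ** R) $ i $ i = 1" "(R ** transpose R) $ i $ i = 1" for i
      by (simp_all add: RR RR' mat_def)
    then show "(\<Sum>j\<in>UNIV. (R $ j $ i)\<^sup>2) = 1" "(\<Sum>j\<in>UNIV. (R $ i $ j)\<^sup>2) = 1" for i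
      by (simp_all add: matrix_matrix_mult_def transpose_def power2_eq_square)
    show "(transpose Q ** T ** Q) $ i $ i = (\<Sum>j\<in>UNIV. (R $ j $ i)\<^sup>2 * l $ j)" for i
    proof -
      have "(transpose R ** diagonal l ** R) $ i $ i = (\<Sum>j\<in>UNIV. (transpose R ** diagonal l) $ i $ j * R $ j $ i)"
        by (simp add: matrix_matrix_mult_def)
      then show ?thesis
        unfolding D diagonal_mult_right by (simp add: transpose_def power2_eq_square mult_ac)
    qed
  qed simp
qed

section \<open>Partial derivatives and smooth functions\<close>

lemma has_derivative_sum_partials:
  fixes F :: "real^'n \<Rightarrow> real"
  assumes "F differentiable (at x)"
  shows "(F has_derivative (\<lambda>v. \<Sum>i\<in>UNIV. v $ i * partial i F x)) (at x)"
proof -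
  let ?D = "frechet_derivative F (at x)"
  have D: "(F has_derivative ?D) (at x)" using assms frechet_derivative_works by blast
  then have lin: "linear ?D" by (rule has_derivative_linear)
  have "?D v = (\<Sum>i\<in>UNIV. v $ i * partial i F x)" for v
  proof -
    have "?D v = ?D (\<Sum>i\<in>UNIV. v $ i *\<^sub>R axis i 1)"
      using basis_expansion[of v] by (simp add: scalar_mult_eq_scaleR)
    also have "\<dots> = (\<Sum>i\<in>UNIV. v $ i * partial i F x)"
      by (simp add: linear_sum[OF lin] linear_scale[OF lin] partial_def)
    finally show ?thesis .
  qed
  then show ?thesis using D by presburger
qed

lemma partial_eqI:
  assumes "(F has_derivative D) (at x)"
  shows "partial i F x = D (axis i 1)"
  unfolding partial_def using frechet_derivative_at[OF assms] by simp

lemma has_derivative_along_line: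
  fixes F :: "real^'n \<Rightarrow> real"
  assumes "F differentiable (at (x + t *\<^sub>R v))"
  shows "((\<lambda>t. F (x + t *\<^sub>R v)) has_real_derivative
    (\<Sum>i\<in>UNIV. v $ i * partial i F (x + t *\<^sub>R v))) (at t)"
proof -
  have "((\<lambda>t. x + t *\<^sub>R v) has_derivative (\<lambda>h. h *\<^sub>R v)) (at t)"
    by (auto intro!: derivative_eq_intros)
  from has_derivative_compose[OF this has_derivative_sum_partials[OF assms]]
  have "((\<lambda>t. F (x + t *\<^sub>R v)) has_derivative
      (\<lambda>h. \<Sum>i\<in>UNIV. (h *\<^sub>R v) $ i * partial i F (x + t *\<^sub>R v))) (at t)" .
  moreover have "(\<lambda>h. \<Sum>i\<in>UNIV. (h *\<^sub>R v) $ i * partial i F (x + t *\<^sub>R v)) =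
      (*) (\<Sum>i\<in>UNIV. v $ i * partial i F (x + t *\<^sub>R v))"
    by (simp add: fun_eq_iff sum_distrib_left sum_distrib_right mult_ac)
  ultimately show ?thesis by (simp add: has_field_derivative_def)
qed

lemma line_in_open:
  fixes S :: "'a::real_normed_vector set"
  assumes "open S" "x \<in> S"
  shows "\<forall>\<^sub>F t in nhds 0. x + t *\<^sub>R v \<in> S"
proof -
  have "((\<lambda>t. x + t *\<^sub>R v) \<longlongrightarrow> x + 0 *\<^sub>R v) (nhds 0)"
    by (intro tendsto_intros filterlim_ident)
  then show ?thesis using assms topological_tendstoD by fastforce
qed

lemma partial_cong_open:
  assumes "open S" "x \<in> S" "\<And>y. y \<in> S \<Longrightarrow> F y = G y"
  shows "partial i F x = partial i G x"
proof -
  have "(F has_derivative D) (at x) \<longleftrightarrow> (G has_derivative D) (at x)" for D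
    using has_derivative_transform_within_open[OF _ assms(1,2), of F D UNIV G]
      has_derivative_transform_within_open[OF _ assms(1,2), of G D UNIV F] assms(3) by auto
  then show ?thesis by (simp add: partial_def frechet_derivative_def)
qed

lemma partial_const: "partial i (\<lambda>_. c) x = 0"
  by (simp add: partial_def)

lemma partial_cmult:
  assumes "F differentiable (at x)"
  shows "partial i (\<lambda>y. c * F y) x = c * partial i F x"
  using partial_eqI[OF has_derivative_mult_right[OF assms[unfolded frechet_derivative_works]]]
  by (simp add: partial_def)

lemma partial_add:
  assumes "F differentiable (at x)" "G differentiable (at x)"
  shows "partial i (\<lambda>y. F y + G y) x = partial i F x + partial i G x"
  using partial_eqI[OF has_derivative_add[OF assms[unfolded frechet_derivative_works]]]
  by (simp add: partial_def)

lemma partial_diff: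
  assumes "F differentiable (at x)" "G differentiable (at x)"
  shows "partial i (\<lambda>y. F y - G y) x = partial i F x - partial i G x"
  using partial_eqI[OF has_derivative_diff[OF assms[unfolded frechet_derivative_works]]]
  by (simp add: partial_def)

lemma partial_mult:
  assumes "F differentiable (at x)" "G differentiable (at x)"
  shows "partial i (\<lambda>y. F y * G y) x = partial i F x * G x + F x * partial i G x"
  using partial_eqI[OF has_derivative_mult[OF assms[unfolded frechet_derivative_works]]]
  by (simp add: partial_def)

lemma partial_sum:
  assumes "\<And>k. k \<in> K \<Longrightarrow> F k differentiable (at x)"
  shows "partial i (\<lambda>y. \<Sum>k\<in>K. F k y) x = (\<Sum>k\<in>K. partial i (F k) x)"
proof -
  have "((\<lambda>y. \<Sum>k\<in>K. F k y) has_derivative (\<lambda>v. \<Sum>k\<in>K. frechet_derivative (F k) (at x) v)) (at x)"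
    using assms by (intro has_derivative_sum) (simp add: frechet_derivative_works)
  from partial_eqI[OF this] show ?thesis by (simp add: partial_def)
qed

lemma has_derivative_exp_comp:
  fixes F :: "'a::real_normed_vector \<Rightarrow> real"
  assumes "(F has_derivative D) (at x)"
  shows "((\<lambda>y. exp (F y)) has_derivative (\<lambda>v. exp (F x) * D v)) (at x)"
  using has_derivative_compose[OF assms DERIV_exp[unfolded has_field_derivative_def]] by simp

lemma partial_exp:
  fixes F :: "real^'n \<Rightarrow> real"
  assumes "F differentiable (at x)"
  shows "partial i (\<lambda>y. exp (F y)) x = exp (F x) * partial i F x"
  using partial_eqI[OF has_derivative_exp_comp[OF assms[unfolded frechet_derivative_works]]]
  by (simp add: partial_def)

lemma differentiable_exp_comp:
  fixes F :: "'a::real_normed_vector \<Rightarrow> real"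
  shows "F differentiable (at x) \<Longrightarrow> (\<lambda>y. exp (F y)) differentiable (at x)"
  using has_derivative_exp_comp unfolding differentiable_def by blast

lemma differentiable_cong_open:
  assumes "F differentiable (at x)" "open S" "x \<in> S" "\<And>y. y \<in> S \<Longrightarrow> F y = G y"
  shows "G differentiable (at x)"
  using assms has_derivative_transform_within_open[OF _ assms(2,3), of F _ UNIV G]
  unfolding differentiable_def by auto

lemma Ck_on_cong:
  assumes "open S" "\<And>y. y \<in> S \<Longrightarrow> F y = G y" "Ck_on k S F"
  shows "Ck_on k S G"
  using assms(2,3)
proof (induction k arbitrary: F G)
  case 0
  then show ?case using continuous_on_cong[of S S F G] by simp
next
  case (Suc k)
  have "partial i F y = partial i G y" if "y \<in> S" for i y
    using partial_cong_open[OF assms(1) that] Suc.prems(1) by blast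
  then have "Ck_on k S (partial i G)" for i
    by (rule Suc.IH) (use Suc.prems in auto)
  moreover have "G differentiable (at y)" if "y \<in> S" for y
    by (rule differentiable_cong_open[OF _ assms(1), of F]) (use Suc.prems that in auto)
  ultimately show ?case by simp
qed

lemma Ck_on_SucD: "Ck_on (Suc k) S F \<Longrightarrow> Ck_on k S F"
proof (induction k arbitrary: F)
  case 0
  then show ?case
    by (simp add: continuous_at_imp_continuous_on differentiable_imp_continuous_within)
qed auto

lemma Ck_on_subset: "Ck_on k S F \<Longrightarrow> T \<subseteq> S \<Longrightarrow> Ck_on k T F"
  by (induction k arbitrary: F) (auto intro: continuous_on_subset)

lemma Ck_on_add:
  assumes S: "open S"
  shows "Ck_on k S F \<Longrightarrow> Ck_on k S G \<Longrightarrow> Ck_on k S (\<lambda>y. F y + G y)"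
proof (induction k arbitrary: F G)
  case (Suc k)
  have "Ck_on k S (partial i (\<lambda>y. F y + G y))" for i
    by (rule Ck_on_cong[OF S _ Suc.IH[of "partial i F" "partial i G"]])
      (use Suc.prems in \<open>auto simp: partial_add\<close>)
  then show ?case using Suc.prems by auto
qed (auto intro: continuous_intros)

lemma Ck_on_mult:
  assumes S: "open S"
  shows "Ck_on k S F \<Longrightarrow> Ck_on k S G \<Longrightarrow> Ck_on k S (\<lambda>y. F y * G y)"
proof (induction k arbitrary: F G)
  case (Suc k)
  have "Ck_on k S (partial i (\<lambda>y. F y * G y))" for i
  proof -
    have "Ck_on k S F" "Ck_on k S G" using Suc.prems Ck_on_SucD by blast+
    then have "Ck_on k S (\<lambda>y. partial i F y * G y + F y * partial i G y)"
      using Suc.prems by (intro Ck_on_add[OF S] Suc.IH) auto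
    then show ?thesis
      by (rule Ck_on_cong[OF S, rotated]) (use Suc.prems in \<open>auto simp: partial_mult\<close>)
  qed
  then show ?case using Suc.prems by auto
qed (auto intro: continuous_intros)

lemma Ck_on_exp:
  assumes S: "open S"
  shows "Ck_on k S F \<Longrightarrow> Ck_on k S (\<lambda>y. exp (F y))"
proof (induction k)
  case (Suc k)
  have "Ck_on k S (partial i (\<lambda>y. exp (F y)))" for i
  proof -
    have "Ck_on k S F" using Suc.prems Ck_on_SucD by blast
    then have "Ck_on k S (\<lambda>y. exp (F y) * partial i F y)"
      using Suc by (intro Ck_on_mult[OF S]) auto
    then show ?thesis
      by (rule Ck_on_cong[OF S, rotated]) (use Suc.prems in \<open>auto simp: partial_exp\<close>)
  qed
  then show ?case using Suc.prems differentiable_exp_comp by auto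
qed (auto intro: continuous_intros)

lemma Ck_on_const: "Ck_on k S (\<lambda>_. c)"
proof (induction k arbitrary: c)
  case (Suc k)
  have "partial i (\<lambda>_. c) = (\<lambda>_. 0)" for i :: 'a by (simp add: fun_eq_iff partial_const)
  with Suc show ?case by simp
qed simp

lemma smooth_on_cong: "open S \<Longrightarrow> (\<And>y. y \<in> S \<Longrightarrow> F y = G y) \<Longrightarrow> smooth_on S F \<Longrightarrow> smooth_on S G"
  unfolding smooth_on_def using Ck_on_cong by blast

lemma smooth_on_subset: "smooth_on S F \<Longrightarrow> T \<subseteq> S \<Longrightarrow> smooth_on T F"
  unfolding smooth_on_def using Ck_on_subset by blast

lemma smooth_on_mult: "open S \<Longrightarrow> smooth_on S F \<Longrightarrow> smooth_on S G \<Longrightarrow> smooth_on S (\<lambda>y. F y * G y)"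
  unfolding smooth_on_def using Ck_on_mult by blast

lemma smooth_on_exp: "open S \<Longrightarrow> smooth_on S F \<Longrightarrow> smooth_on S (\<lambda>y. exp (F y))"
  unfolding smooth_on_def using Ck_on_exp by blast

lemma smooth_on_cmult: "open S \<Longrightarrow> smooth_on S F \<Longrightarrow> smooth_on S (\<lambda>y. c * F y)"
  unfolding smooth_on_def using Ck_on_mult Ck_on_const by blast

lemma smooth_on_diff: "open S \<Longrightarrow> smooth_on S F \<Longrightarrow> smooth_on S G \<Longrightarrow> smooth_on S (\<lambda>y. F y - G y)"
  using Ck_on_add[of S _ F "\<lambda>y. -1 * G y"] Ck_on_mult[of S _ "\<lambda>_. -1" G] Ck_on_const[of _ S "-1"]
  by (simp add: smooth_on_def)

lemma smooth_on_partial: "smooth_on S F \<Longrightarrow> smooth_on S (partial i F)"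
  unfolding smooth_on_def using Ck_on.simps(2) by blast

lemma smooth_on_continuous: "smooth_on S F \<Longrightarrow> continuous_on S F"
  unfolding smooth_on_def using Ck_on.simps(1) by blast

lemma smooth_on_differentiable: "smooth_on S F \<Longrightarrow> x \<in> S \<Longrightarrow> F differentiable (at x)"
  unfolding smooth_on_def using Ck_on.simps(2) by blast

lemma DERIV_along_axis:
  assumes "F differentiable (at (x + t *\<^sub>R axis i 1))"
  shows "((\<lambda>t. F (x + t *\<^sub>R axis i 1)) has_real_derivative partial i F (x + t *\<^sub>R axis i 1)) (at t)"
  using has_derivative_along_line[OF assms]
  by (simp add: axis_def if_distrib[of "\<lambda>x. x * _"] cong: if_cong)

text \<open>The mean value theorem is applied in direction \<open>i\<close> to the increment in direction \<open>j\<close>, then in direction \<open>j\<close>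
  to the resulting difference of first derivatives. The left side is symmetric in \<open>i\<close> and \<open>j\<close>.\<close>

lemma second_difference_mean_value:
  fixes F :: "real^'n \<Rightarrow> real"
  assumes F: "smooth_on S F" and h: "h > 0"
    and S: "\<And>s t. 0 \<le> s \<Longrightarrow> s \<le> h \<Longrightarrow> 0 \<le> t \<Longrightarrow> t \<le> h \<Longrightarrow> x + s *\<^sub>R axis i 1 + t *\<^sub>R axis j 1 \<in> S"
  shows "\<exists>s t. 0 \<le> s \<and> s \<le> h \<and> 0 \<le> t \<and> t \<le> h \<and>
    F (x + h *\<^sub>R axis i 1 + h *\<^sub>R axis j 1) - F (x + h *\<^sub>R axis i 1)
      - (F (x + h *\<^sub>R axis j 1) - F x)
    = h * (h * partial j (partial i F) (x + s *\<^sub>R axis i 1 + t *\<^sub>R axis j 1))"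
proof -
  have diff: "F differentiable (at (x + s *\<^sub>R axis i 1 + t *\<^sub>R axis j 1))"
    "partial i F differentiable (at (x + s *\<^sub>R axis i 1 + t *\<^sub>R axis j 1))"
    if "0 \<le> s" "s \<le> h" "0 \<le> t" "t \<le> h" for s t
    using smooth_on_differentiable[OF _ S[OF that]] F smooth_on_partial by blast+
  define \<phi> where "\<phi> s = F ((x + h *\<^sub>R axis j 1) + s *\<^sub>R axis i 1) - F (x + s *\<^sub>R axis i 1)" for s
  have "(\<phi> has_real_derivative
      partial i F ((x + h *\<^sub>R axis j 1) + s *\<^sub>R axis i 1) - partial i F (x + s *\<^sub>R axis i 1)) (at s)"
    if "0 \<le> s" "s \<le> h" for s
    unfolding \<phi>_def using diff(1)[of s h] diff(1)[of s 0] that h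
    by (intro DERIV_diff DERIV_along_axis) (simp_all add: add_ac)
  then obtain s where s: "0 < s" "s < h" "\<phi> h - \<phi> 0 = (h - 0) *
      (partial i F ((x + h *\<^sub>R axis j 1) + s *\<^sub>R axis i 1) - partial i F (x + s *\<^sub>R axis i 1))"
    using MVT2[OF h, of \<phi> "\<lambda>s. partial i F ((x + h *\<^sub>R axis j 1) + s *\<^sub>R axis i 1)
      - partial i F (x + s *\<^sub>R axis i 1)"] by blast
  have "((\<lambda>t. partial i F ((x + s *\<^sub>R axis i 1) + t *\<^sub>R axis j 1)) has_real_derivative
      partial j (partial i F) ((x + s *\<^sub>R axis i 1) + t *\<^sub>R axis j 1)) (at t)"
    if "0 \<le> t" "t \<le> h" for t
    using diff(2)[of s t] that s by (intro DERIV_along_axis) simp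
  then obtain t where t: "0 < t" "t < h"
    "partial i F ((x + s *\<^sub>R axis i 1) + h *\<^sub>R axis j 1) - partial i F ((x + s *\<^sub>R axis i 1) + 0 *\<^sub>R axis j 1)
      = (h - 0) * partial j (partial i F) ((x + s *\<^sub>R axis i 1) + t *\<^sub>R axis j 1)"
    using MVT2[OF h, of "\<lambda>t. partial i F ((x + s *\<^sub>R axis i 1) + t *\<^sub>R axis j 1)"
        "\<lambda>t. partial j (partial i F) ((x + s *\<^sub>R axis i 1) + t *\<^sub>R axis j 1)"] by blast
  have "\<phi> h - \<phi> 0 = F (x + h *\<^sub>R axis i 1 + h *\<^sub>R axis j 1) - F (x + h *\<^sub>R axis i 1)
      - (F (x + h *\<^sub>R axis j 1) - F x)"
    by (simp add: \<phi>_def add_ac)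
  then show ?thesis using s t
    by (intro exI[of _ s] exI[of _ t]) (simp add: add_ac)
qed

text \<open>Both mixed derivatives are limits of the same second difference quotient.\<close>

lemma partial_commute:
  fixes F :: "real^'n \<Rightarrow> real"
  assumes F: "smooth_on S F" and S: "open S" "x \<in> S"
  shows "partial i (partial j F) x = partial j (partial i F) x"
proof (rule ccontr)
  let ?A = "partial i (partial j F)" and ?B = "partial j (partial i F)"
  assume neq: "?A x \<noteq> ?B x"
  define e where "e = dist (?A x) (?B x) / 2"
  have e: "e > 0" using neq by (simp add: e_def)
  have "isCont ?A x" "isCont ?B x"
    using smooth_on_differentiable[OF smooth_on_partial[OF smooth_on_partial[OF F]] S(2)]
      differentiable_imp_continuous_within by blast+
  then obtain d1 d2 where d1: "d1 > 0" "\<And>y. dist y x < d1 \<Longrightarrow> dist (?A y) (?A x) < e"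
    and d2: "d2 > 0" "\<And>y. dist y x < d2 \<Longrightarrow> dist (?B y) (?B x) < e"
    using e unfolding continuous_at_eps_delta dist_norm by metis
  obtain d3 where d3: "d3 > 0" "\<And>y. dist y x < d3 \<Longrightarrow> y \<in> S"
    using S open_dist by blast
  define m where "m = min d1 (min d2 d3)"
  \<comment> \<open>A square of side \<open>h\<close> at \<open>x\<close> stays within distance \<open>2 h < m\<close>.\<close>
  define h where "h = m / 3"
  have m: "m \<le> d1" "m \<le> d2" "m \<le> d3" "m > 0" using d1 d2 d3 by (auto simp: m_def)
  then have h: "h > 0" by (simp add: h_def)
  have near: "dist (x + s *\<^sub>R axis k 1 + t *\<^sub>R axis l 1) x < m"
    if "0 \<le> s" "s \<le> h" "0 \<le> t" "t \<le> h" for s t and k l :: 'n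
  proof -
    have "norm (s *\<^sub>R axis k (1::real) + t *\<^sub>R axis l 1) \<le> norm (s *\<^sub>R axis k (1::real)) + norm (t *\<^sub>R axis l (1::real))"
      by (rule norm_triangle_ineq)
    also have "\<dots> \<le> 2 * h" using that by simp
    also have "\<dots> < m" using m(4) by (simp add: h_def)
    finally show ?thesis by (simp add: dist_norm add.assoc)
  qed
  have inS: "x + s *\<^sub>R axis k 1 + t *\<^sub>R axis l 1 \<in> S"
    if "0 \<le> s" "s \<le> h" "0 \<le> t" "t \<le> h" for s t and k l :: 'n
    using near[OF that] m(3) by (intro d3(2)) (rule less_le_trans)
  obtain s t where st: "0 \<le> s" "s \<le> h" "0 \<le> t" "t \<le> h"
    "F (x + h *\<^sub>R axis i 1 + h *\<^sub>R axis j 1) - F (x + h *\<^sub>R axis i 1)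
      - (F (x + h *\<^sub>R axis j 1) - F x) = h * (h * ?B (x + s *\<^sub>R axis i 1 + t *\<^sub>R axis j 1))"
    using second_difference_mean_value[OF F h inS] by blast
  obtain s' t' where st': "0 \<le> s'" "s' \<le> h" "0 \<le> t'" "t' \<le> h"
    "F (x + h *\<^sub>R axis j 1 + h *\<^sub>R axis i 1) - F (x + h *\<^sub>R axis j 1)
      - (F (x + h *\<^sub>R axis i 1) - F x) = h * (h * ?A (x + s' *\<^sub>R axis j 1 + t' *\<^sub>R axis i 1))"
    using second_difference_mean_value[OF F h inS] by blast
  have "h * (h * ?B (x + s *\<^sub>R axis i 1 + t *\<^sub>R axis j 1)) = h * (h * ?A (x + s' *\<^sub>R axis j 1 + t' *\<^sub>R axis i 1))"
    unfolding st(5)[symmetric] st'(5)[symmetric] by (simp add: add_ac)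
  then have "?B (x + s *\<^sub>R axis i 1 + t *\<^sub>R axis j 1) = ?A (x + s' *\<^sub>R axis j 1 + t' *\<^sub>R axis i 1)"
    using h by simp
  moreover have "dist (?B (x + s *\<^sub>R axis i 1 + t *\<^sub>R axis j 1)) (?B x) < e"
    using near[OF st(1-4)] m(2) by (intro d2(2)) (rule less_le_trans)
  moreover have "dist (?A (x + s' *\<^sub>R axis j 1 + t' *\<^sub>R axis i 1)) (?A x) < e"
    using near[OF st'(1-4)] m(1) by (intro d1(2)) (rule less_le_trans)
  ultimately show False
    using dist_triangle_less_add[of "?A x" "?A (x + s' *\<^sub>R axis j 1 + t' *\<^sub>R axis i 1)" e "?B x" e]
    by (simp add: e_def dist_commute)
qed

text \<open>If the second derivative along \<open>v\<close> were negative, the first derivative, which vanishes at \<open>x\<close>, would be negative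
  shortly after \<open>x\<close>, and \<open>F\<close> would drop below its minimum.\<close>

lemma second_derivative_test:
  fixes F :: "real^'n \<Rightarrow> real"
  assumes F: "smooth_on S F" and S: "open S" "x \<in> S" and min: "\<And>y. y \<in> S \<Longrightarrow> F x \<le> F y"
  shows "partial i F x = 0"
    and "0 \<le> (\<Sum>i\<in>UNIV. \<Sum>j\<in>UNIV. v $ i * v $ j * partial i (partial j F) x)"
proof -
  obtain d where d: "d > 0" "ball x d \<subseteq> S" using S open_contains_ball by blast
  show "partial i F x = 0" for i
  proof (rule DERIV_local_min)
    show "((\<lambda>t. F (x + t *\<^sub>R axis i 1)) has_real_derivative partial i F x) (at 0)"
      using DERIV_along_axis[of F x 0 i] smooth_on_differentiable[OF F S(2)] by simp
    show "\<forall>t. \<bar>0 - t\<bar> < d \<longrightarrow> F (x + 0 *\<^sub>R axis i 1) \<le> F (x + t *\<^sub>R axis i 1)"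
      using d by (auto intro!: min simp: subset_iff dist_norm)
  qed (rule d)
  show "0 \<le> (\<Sum>i\<in>UNIV. \<Sum>j\<in>UNIV. v $ i * v $ j * partial i (partial j F) x)" (is "0 \<le> ?q")
  proof (rule ccontr)
    assume "\<not> 0 \<le> ?q"
    then have q: "?q < 0" by simp
    define \<psi> where "\<psi> t = (\<Sum>j\<in>UNIV. v $ j * partial j F (x + t *\<^sub>R v))" for t
    obtain r where r: "r > 0" "\<And>t. \<bar>t\<bar> < r \<Longrightarrow> x + t *\<^sub>R v \<in> S"
      using line_in_open[OF S, of v] unfolding eventually_nhds_metric by (auto simp: dist_norm)
    have D1: "((\<lambda>t. F (x + t *\<^sub>R v)) has_real_derivative \<psi> t) (at t)" if "\<bar>t\<bar> < r" for t
      unfolding \<psi>_def using smooth_on_differentiable[OF F r(2)[OF that]] by (rule has_derivative_along_line)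
    have "(\<psi> has_real_derivative (\<Sum>j\<in>UNIV. v $ j * (\<Sum>i\<in>UNIV. v $ i * partial i (partial j F) (x + 0 *\<^sub>R v)))) (at 0)"
      unfolding \<psi>_def using smooth_on_differentiable[OF smooth_on_partial[OF F] S(2)]
      by (intro DERIV_sum DERIV_cmult has_derivative_along_line) simp
    also have "(\<Sum>j\<in>UNIV. v $ j * (\<Sum>i\<in>UNIV. v $ i * partial i (partial j F) (x + 0 *\<^sub>R v))) = ?q"
      by (subst sum.swap) (simp add: sum_distrib_left mult_ac)
    finally have "(\<psi> has_real_derivative ?q) (at 0)" .
    from DERIV_neg_dec_right[OF this q]
    obtain e where e: "e > 0" "\<And>t. t > 0 \<Longrightarrow> t < e \<Longrightarrow> \<psi> t < \<psi> 0" by auto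
    have "\<psi> 0 = 0" unfolding \<psi>_def using \<open>\<And>i. partial i F x = 0\<close> by simp
    define b where "b = min r e / 2"
    have b: "b > 0" "b < r" "b < e" using r(1) e(1) by (auto simp: b_def)
    then obtain t where t: "0 < t" "t < b" "F (x + b *\<^sub>R v) - F (x + 0 *\<^sub>R v) = (b - 0) * \<psi> t"
      using MVT2[of 0 b "\<lambda>t. F (x + t *\<^sub>R v)" \<psi>] D1 by auto
    have "\<psi> t < 0" using e(2)[of t] t b \<open>\<psi> 0 = 0\<close> by simp
    then have "(b - 0) * \<psi> t < 0" using b by (simp add: mult_pos_neg)
    moreover have "F x \<le> F (x + b *\<^sub>R v)" using b by (intro min r(2)) simp
    ultimately show False using t(3) by simp
  qed
qed

section \<open>Concave symmetric functions on the cone\<close>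

lemma permutation_to_increasing:
  fixes l :: "real^'n::{finite,linorder}"
  obtains \<pi> :: "'n \<Rightarrow> 'n" where "bij \<pi>" "\<And>i j. i \<le> j \<Longrightarrow> l $ \<pi> i \<le> l $ \<pi> j"
proof -
  define us where "us = sorted_list_of_set (UNIV :: 'n set)"
  define xs where "xs = sort_key (($) l) us"
  have us: "sorted us" "distinct us" "set us = UNIV" "length us = CARD('n)"
    by (simp_all add: us_def)
  have xs: "sorted (map (($) l) xs)" "distinct xs" "set xs = UNIV" "length xs = CARD('n)"
    using us by (simp_all add: xs_def)
  have bus: "bij_betw ((!) us) {..<CARD('n)} UNIV" and bxs: "bij_betw ((!) xs) {..<CARD('n)} UNIV"
    using bij_betw_nth[of us "{..<CARD('n)}" UNIV] bij_betw_nth[of xs "{..<CARD('n)}" UNIV] us xs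
    by auto
  define r :: "'n \<Rightarrow> nat" where "r = inv_into {..<CARD('n)} ((!) us)"
  have r: "bij_betw r UNIV {..<CARD('n)}"
    unfolding r_def using bus by (rule bij_betw_inv_into)
  have usr: "us ! r i = i" "r i < CARD('n)" for i
    using bus r by (auto simp: r_def bij_betw_inv_into_right bij_betw_def)
  have "r i \<le> r j" if "i \<le> j" for i j
  proof (rule ccontr)
    assume "\<not> r i \<le> r j"
    then have "us ! r j < us ! r i"
      using us usr by (metis linorder_not_le nat_less_le nth_eq_iff_index_eq order_le_less sorted_nth_mono)
    then show False using that usr by simp
  qed
  then have "l $ (xs ! r i) \<le> l $ (xs ! r j)" if "i \<le> j" for i j
    using sorted_nth_mono[OF xs(1), of "r i" "r j"] that usr xs(4) by simp
  moreover have "bij (\<lambda>i. xs ! r i)"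
    using bij_betw_trans[OF r bxs] by (simp add: comp_def)
  ultimately show ?thesis using that[of "\<lambda>i. xs ! r i"] by blast
qed

text \<open>Abel summation: the weights \<open>a\<close> decrease, so replacing the weights of an initial segment by the next smaller one only
  lowers the sum, as the partial sums of \<open>c\<close> are nonnegative. The lower bound \<open>m\<close> carries the induction.\<close>

lemma sum_antitone_partial_sums_nonneg:
  fixes a c :: "'n::linorder \<Rightarrow> real"
  assumes "finite A" and "\<And>i j. i \<in> A \<Longrightarrow> j \<in> A \<Longrightarrow> i \<le> j \<Longrightarrow> a j \<le> a i"
    and "\<And>k. k \<in> A \<Longrightarrow> 0 \<le> sum c {i\<in>A. i \<le> k}" and "\<And>i. i \<in> A \<Longrightarrow> m \<le> a i"
  shows "m * sum c A \<le> (\<Sum>i\<in>A. a i * c i)"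
  using assms
proof (induction A arbitrary: m rule: finite_linorder_max_induct)
  case (insert b A)
  have nb: "b \<notin> A" and fin: "finite A" using insert.hyps by auto
  have part: "{i \<in> insert b A. i \<le> k} = {i \<in> A. i \<le> k}" if "k \<in> A" for k
    using insert.hyps that by auto
  have "a b * sum c A \<le> (\<Sum>i\<in>A. a i * c i)"
  proof (rule insert.IH)
    show "0 \<le> sum c {i \<in> A. i \<le> k}" if "k \<in> A" for k
      using insert.prems(2)[of k] part[OF that] that by simp
  qed (use insert.prems(1) insert.hyps in \<open>auto simp: less_imp_le\<close>)
  moreover have "0 \<le> sum c (insert b A)"
  proof -
    have "{i \<in> insert b A. i \<le> b} = insert b A" using insert.hyps by auto
    then show ?thesis using insert.prems(2)[of b] by simp
  qed
  then have "m * sum c (insert b A) \<le> a b * sum c (insert b A)"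
    using insert.prems(3)[of b] by (intro mult_right_mono) auto
  ultimately show ?case using nb fin by (simp add: algebra_simps)
qed simp

text \<open>Averaging an increasing vector \<open>b\<close> by a doubly stochastic matrix can only raise its initial partial sums: among all
  weights between 0 and 1 of given total \<open>card {..k}\<close>, those of the first entries give the smallest weighted sum.
  Abel summation against the decreasing \<open>a\<close> finishes the proof.\<close>

lemma doubly_stochastic_rearrangement:
  fixes a b :: "'n::{finite,linorder} \<Rightarrow> real"
  assumes P: "\<And>i j. P i j \<ge> 0" "\<And>i. (\<Sum>j\<in>UNIV. P i j) = 1" "\<And>j. (\<Sum>i\<in>UNIV. P i j) = 1"
    and a: "\<And>i j. i \<le> j \<Longrightarrow> a j \<le> a i" and b: "\<And>i j. i \<le> j \<Longrightarrow> b i \<le> b j"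
  shows "(\<Sum>i\<in>UNIV. a i * b i) \<le> (\<Sum>i\<in>UNIV. a i * (\<Sum>j\<in>UNIV. P i j * b j))"
proof -
  define c where "c i = (\<Sum>j\<in>UNIV. P i j * b j) - b i" for i
  have "0 \<le> sum c {..k}" for k
  proof -
    define q where "q j = (\<Sum>i\<le>k. P i j)" for j
    have q: "0 \<le> q j" "q j \<le> 1" for j
      using P(1) P(3)[of j] sum_mono2[of UNIV "{..k}" "\<lambda>i. P i j"] by (auto simp: q_def sum_nonneg)
    have "sum c {..k} = (\<Sum>j\<in>UNIV. (q j - of_bool (j \<le> k)) * b j)"
    proof -
      have "(\<Sum>i\<le>k. \<Sum>j\<in>UNIV. P i j * b j) = (\<Sum>j\<in>UNIV. q j * b j)"
        by (subst sum.swap) (simp add: q_def sum_distrib_right)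
      moreover have "(\<Sum>i\<le>k. b i) = (\<Sum>j\<in>UNIV. of_bool (j \<le> k) * b j)"
        by (simp add: of_bool_def if_distrib[of "\<lambda>x. x * _"] sum.If_cases atMost_def cong: if_cong)
      ultimately show ?thesis by (simp add: c_def sum_subtractf left_diff_distrib)
    qed
    moreover have "(\<Sum>j\<in>UNIV. (q j - of_bool (j \<le> k)) * b k) = 0"
    proof -
      have "(\<Sum>j\<in>UNIV. q j) = (\<Sum>i\<le>k. 1)"
        unfolding q_def by (subst sum.swap) (simp add: P(2))
      moreover have "(\<Sum>j\<in>UNIV. of_bool (j \<le> k)) = (\<Sum>i\<le>k. 1 :: real)"
        by (simp add: of_bool_def sum.If_cases atMost_def)
      ultimately show ?thesis by (simp add: sum_distrib_right[symmetric] sum_subtractf)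
    qed
    \<comment> \<open>The total weight is zero, so \<open>b k\<close> may be subtracted; then each summand is nonnegative,
      since \<open>b j - b k\<close> changes sign where \<open>of_bool (j \<le> k)\<close> jumps from 1 to 0.\<close>
    ultimately have "sum c {..k} = (\<Sum>j\<in>UNIV. (q j - of_bool (j \<le> k)) * (b j - b k))"
      by (simp add: right_diff_distrib sum_subtractf)
    also have "\<dots> \<ge> 0"
    proof (rule sum_nonneg)
      fix j
      show "0 \<le> (q j - of_bool (j \<le> k)) * (b j - b k)"
        using q[of j] b[of j k] b[of k j]
        by (cases "j \<le> k") (auto intro: mult_nonpos_nonpos)
    qed
    finally show ?thesis .
  qed
  moreover have "sum c UNIV = 0"
  proof -
    have "(\<Sum>i\<in>UNIV. \<Sum>j\<in>UNIV. P i j * b j) = (\<Sum>j\<in>UNIV. b j)"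
      by (subst sum.swap) (simp add: P(3) sum_distrib_right[symmetric])
    then show ?thesis by (simp add: c_def sum_subtractf)
  qed
  ultimately have "0 \<le> (\<Sum>i\<in>UNIV. a i * c i)"
    using sum_antitone_partial_sums_nonneg[of UNIV a c "Min (range a)"] a
    by (simp add: atMost_def)
  then show ?thesis by (simp add: c_def right_diff_distrib sum_subtractf)
qed

text \<open>Concavity bounds the slope of the chord from \<open>x\<close> to \<open>y\<close> by the difference quotients at \<open>x\<close> in the direction
  \<open>y - x\<close>, and these tend to the directional derivative.\<close>

lemma concave_on_below_tangent:
  fixes f :: "real^'n \<Rightarrow> real"
  assumes f: "concave_on S f" and x: "x \<in> S" "f differentiable (at x)" and y: "y \<in> S"
  shows "f y \<le> f x + (\<Sum>i\<in>UNIV. partial i f x * (y $ i - x $ i))"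
proof -
  let ?d = "\<Sum>i\<in>UNIV. (y - x) $ i * partial i f x"
  have S: "convex S" using f by (simp add: concave_on_def convex_on_def)
  have "((\<lambda>t. f (x + t *\<^sub>R (y - x))) has_real_derivative ?d) (at 0)"
    using has_derivative_along_line[of f x 0 "y - x"] x(2) by simp
  then have lim: "((\<lambda>t. (f (x + t *\<^sub>R (y - x)) - f x) / t) \<longlongrightarrow> ?d) (at_right 0)"
    by (auto simp: has_field_derivative_iff intro: filterlim_at_within_not_equal tendsto_within_subset)
  have "f y - f x \<le> (f (x + t *\<^sub>R (y - x)) - f x) / t" if t: "0 < t" "t < 1" for t
  proof -
    have "(1 - t) * f x + t * f y \<le> f ((1 - t) *\<^sub>R x + t *\<^sub>R y)"
      using f x(1) y t unfolding concave_on_iff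
      by (metis add.commute diff_add_cancel diff_ge_0_iff_ge less_imp_le)
    also have "(1 - t) *\<^sub>R x + t *\<^sub>R y = x + t *\<^sub>R (y - x)" by (simp add: algebra_simps)
    finally show ?thesis using t by (simp add: field_simps)
  qed
  then have "eventually (\<lambda>t. f y - f x \<le> (f (x + t *\<^sub>R (y - x)) - f x) / t) (at_right 0)"
    using eventually_at_right_less[of "0::real"] by (auto simp: eventually_at_right_field intro: exI[of _ 1])
  from tendsto_lowerbound[OF lim this] show ?thesis by (simp add: mult.commute)
qed

context
  fixes \<Gamma> :: "(real^'n::{finite,linorder}) set" and f :: "real^'n::{finite,linorder} \<Rightarrow> real"
  assumes cone: "symmetric_cone \<Gamma>" and f: "elliptic_concave \<Gamma> f"
begin

lemma elliptic_concave_differentiable: "l \<in> \<Gamma> \<Longrightarrow> f differentiable (at l)"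
  using f by (auto simp: elliptic_concave_def smooth_on_def dest: spec[of _ "Suc 0"])

lemma permuted_in_cone:
  assumes "l \<in> \<Gamma>" "bij \<pi>"
  shows "(\<chi> i. l $ \<pi> i) \<in> \<Gamma>" "f (\<chi> i. l $ \<pi> i) = f l"
  using cone f assms by (auto simp: symmetric_cone_def elliptic_concave_def symmetric_fun_def)

text \<open>Compare \<open>b\<close> with the vector obtained by exchanging its entries \<open>i\<close> and \<open>j\<close>: \<open>f\<close> has the same value at both, and
  the tangent inequality at \<open>b\<close> becomes \<open>0 \<le> (f\<^sub>i - f\<^sub>j) (b\<^sub>j - b\<^sub>i)\<close>. When the two entries agree this says
  nothing; then the two partial derivatives are equal by symmetry.\<close>

lemma gradient_antitone:
  assumes b: "b \<in> \<Gamma>" and le: "b $ i \<le> b $ j"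
  shows "partial j f b \<le> partial i f b"
proof (cases "b $ i = b $ j")
  case True
  have swap: "f (b + t *\<^sub>R axis j 1) = f (b + t *\<^sub>R axis i 1)" if "b + t *\<^sub>R axis j 1 \<in> \<Gamma>" for t
  proof -
    have "(\<chi> k. (b + t *\<^sub>R axis j 1) $ Transposition.transpose i j k) = b + t *\<^sub>R axis i 1"
      using True by (auto simp: vec_eq_iff Transposition.transpose_def axis_def)
    then show ?thesis using permuted_in_cone(2)[OF that, of "Transposition.transpose i j"] by simp
  qed
  have D: "((\<lambda>t. f (b + t *\<^sub>R axis k 1)) has_real_derivative partial k f b) (at 0)" for k
    using has_derivative_along_line[of f b 0 "axis k 1"] elliptic_concave_differentiable[OF b]
    by (simp add: axis_def if_distrib[of "\<lambda>x. x * _"] cong: if_cong)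
  have "open \<Gamma>" using cone by (simp add: symmetric_cone_def)
  then have "\<forall>\<^sub>F t in nhds 0. f (b + t *\<^sub>R axis j 1) = f (b + t *\<^sub>R axis i 1)"
    using line_in_open[of \<Gamma> b "axis j 1"] b swap by (auto elim: eventually_mono)
  then have "((\<lambda>t. f (b + t *\<^sub>R axis i 1)) has_real_derivative partial j f b) (at 0)"
    using D[of j] by (subst (asm) DERIV_cong_ev[OF refl _ refl])
  then show ?thesis using D[of i] DERIV_unique by fastforce
next
  case False
  let ?b = "\<chi> k. b $ Transposition.transpose i j k"
  have "i \<noteq> j" using False by auto
  have "f ?b \<le> f b + (\<Sum>k\<in>UNIV. partial k f b * (?b $ k - b $ k))"
    using permuted_in_cone(1)[OF b, of "Transposition.transpose i j"] f
    by (intro concave_on_below_tangent[of \<Gamma>] elliptic_concave_differentiable b)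
      (auto simp: elliptic_concave_def)
  also have "(\<Sum>k\<in>UNIV. partial k f b * (?b $ k - b $ k)) = (\<Sum>k\<in>{i, j}. partial k f b * (?b $ k - b $ k))"
    by (rule sum.mono_neutral_right) (auto simp: Transposition.transpose_def)
  also have "\<dots> = (partial i f b - partial j f b) * (b $ j - b $ i)"
    using \<open>i \<noteq> j\<close> by (simp add: algebra_simps)
  finally have "0 \<le> (partial i f b - partial j f b) * (b $ j - b $ i)"
    using permuted_in_cone(2)[OF b, of "Transposition.transpose i j"] by simp
  then show ?thesis using le False by (simp add: zero_le_mult_iff)
qed

text \<open>The tangent inequality may be applied to \<open>l\<close> in increasing order, and in this order the pairing with the decreasing
  gradient is at most its pairing with the averages of \<open>l\<close>.\<close>

lemma comparison_by_gradient:
  assumes b: "b \<in> \<Gamma>" "\<And>i j. i \<le> j \<Longrightarrow> b $ i \<le> b $ j" and l: "l \<in> \<Gamma>"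
    and P: "\<And>i j. P i j \<ge> 0" "\<And>i. (\<Sum>j\<in>UNIV. P i j) = 1" "\<And>j. (\<Sum>i\<in>UNIV. P i j) = 1"
    and grad: "0 \<le> (\<Sum>i\<in>UNIV. partial i f b * (b $ i - (\<Sum>j\<in>UNIV. P i j * l $ j)))"
  shows "f l \<le> f b"
proof -
  obtain \<pi> :: "'n \<Rightarrow> 'n"
    where \<pi>: "bij \<pi>" "\<And>i j. i \<le> j \<Longrightarrow> l $ \<pi> i \<le> l $ \<pi> j"
    by (rule permutation_to_increasing[of l]) (rule that)
  have reindex: "(\<Sum>j\<in>UNIV. h (\<pi> j)) = (\<Sum>j\<in>UNIV. h j)" for h :: "'n \<Rightarrow> real"
    using \<pi>(1) by (rule sum.reindex_bij_betw)
  let ?l = "\<chi> i. l $ \<pi> i"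
  have "f ?l \<le> f b + (\<Sum>i\<in>UNIV. partial i f b * (?l $ i - b $ i))"
    using permuted_in_cone(1)[OF l \<pi>(1)] f
    by (intro concave_on_below_tangent[of \<Gamma>] elliptic_concave_differentiable b(1))
      (auto simp: elliptic_concave_def)
  moreover have "(\<Sum>i\<in>UNIV. partial i f b * ?l $ i)
      \<le> (\<Sum>i\<in>UNIV. partial i f b * (\<Sum>j\<in>UNIV. P i (\<pi> j) * ?l $ j))"
    by (rule doubly_stochastic_rearrangement)
      (use P \<pi>(2) b gradient_antitone reindex[of "P _"] in auto)
  moreover have "(\<Sum>j\<in>UNIV. P i (\<pi> j) * ?l $ j) = (\<Sum>j\<in>UNIV. P i j * l $ j)" for i
    using reindex[of "\<lambda>j. P i j * l $ j"] by simp
  ultimately show ?thesis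
    using grad permuted_in_cone(2)[OF l \<pi>(1)] by (simp add: right_diff_distrib sum_subtractf)
qed

end

text \<open>This transfers statements about an arbitrarily ordered list of eigenvalues to any other ordering of it.\<close>

lemma permuted_in_coneD:
  fixes \<Gamma> :: "(real^'n::{finite,linorder}) set"
  assumes "symmetric_cone \<Gamma>" "elliptic_concave \<Gamma> f" "bij \<pi>" "(\<chi> i. l $ \<pi> i) \<in> \<Gamma>"
  shows "l \<in> \<Gamma>" "f (\<chi> i. l $ \<pi> i) = f l"
proof -
  have "l = (\<chi> i. (\<chi> i. l $ \<pi> i) $ inv \<pi> i)"
    using assms(3) by (simp add: vec_eq_iff bij_is_surj surj_f_inv_f)
  then show "l \<in> \<Gamma>"
    using permuted_in_cone(1)[OF assms(1,2,4) bij_imp_bij_inv[OF assms(3)]] by simp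
  then show "f (\<chi> i. l $ \<pi> i) = f l"
    using permuted_in_cone(2)[OF assms(1,2) _ assms(3)] by blast
qed

lemma strict_mono_position: "i < j \<Longrightarrow> position i < position j"
  unfolding position_def by (rule psubset_card_mono) auto

lemma card_position_le:
  assumes "k \<le> CARD('n::{finite,linorder})"
  shows "card {i::'n. position i \<le> k} = k"
proof -
  have inj: "inj (position :: 'n \<Rightarrow> nat)"
    by (metis injI less_irrefl linorder_neqE strict_mono_position)
  have "range (position :: 'n \<Rightarrow> nat) \<subseteq> {1..CARD('n)}"
  proof (clarsimp, intro conjI)
    fix i :: 'n
    have "card {i} \<le> card {..i}" "card {..i} \<le> card (UNIV :: 'n set)"
      by (rule card_mono; auto)+
    then show "Suc 0 \<le> position i" "position i \<le> CARD('n)" by (auto simp: position_def)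
  qed
  moreover have "card (range (position :: 'n \<Rightarrow> nat)) = card {1..CARD('n)}"
    using card_image[OF inj] by simp
  ultimately have rng: "range (position :: 'n \<Rightarrow> nat) = {1..CARD('n)}"
    by (intro card_subset_eq) auto
  have "position ` {i::'n. position i \<le> k} = {1..k}"
  proof
    show "{1..k} \<subseteq> position ` {i::'n. position i \<le> k}"
    proof
      fix m assume m: "m \<in> {1..k}"
      then have "m \<in> range (position :: 'n \<Rightarrow> nat)" unfolding rng using assms by simp
      with m show "m \<in> position ` {i::'n. position i \<le> k}" by auto
    qed
    show "position ` {i::'n. position i \<le> k} \<subseteq> {1..k}"
      using rng by auto
  qed
  then show ?thesis using card_image[OF inj_on_subset[OF inj subset_UNIV]] by (metis card_atLeastAtMost diff_Suc_1)
qed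

text \<open>A vector all of whose entries are negative has negative trace, so it is not in the cone. The vector
  \<open>(1, \<dots>, 1)\<close> shows that the maximum is over a nonempty set.\<close>

lemma kappa_less_dim:
  fixes \<Gamma> :: "(real^'n::{finite,linorder}) set"
  assumes "symmetric_cone \<Gamma>"
  shows "kappa \<Gamma> < CARD('n)"
proof -
  let ?S = "{k. k \<le> CARD('n) \<and> (\<exists>a :: real^'n::{finite,linorder}. (\<forall>i. a $ i > 0) \<and>
    (\<chi> i. if position i \<le> k then - a $ i else a $ i) \<in> \<Gamma>)}"
  have trace: "(\<Sum>i\<in>UNIV. l $ i) > 0" if "l \<in> \<Gamma>" for l
  proof -
    have "l \<in> garding_cone 1" using assms that by (auto simp: symmetric_cone_def)
    then have "0 < elem_sym 1 l" by (simp add: garding_cone_def)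
    also have "elem_sym 1 l = (\<Sum>S\<in>(\<lambda>i. {i}) ` UNIV. \<Prod>i\<in>S. l $ i)"
      unfolding elem_sym_def by (rule arg_cong2[of _ _ _ _ sum]) (auto simp: card_1_singleton_iff)
    also have "\<dots> = (\<Sum>i\<in>UNIV. l $ i)" by (subst sum.reindex) auto
    finally show ?thesis .
  qed
  have pos: "position i \<noteq> 0" for i :: 'n by (auto simp: position_def card_eq_0_iff)
  have "(\<chi> i::'n. 1) \<in> garding_cone CARD('n)"
  proof -
    have "elem_sym j (\<chi> i::'n. 1) > 0" if "j \<le> CARD('n)" for j
    proof -
      have "{S :: 'n set. card S = j} \<noteq> {}"
        using obtain_subset_with_card_n[OF that] by blast
      then show ?thesis by (simp add: elem_sym_def card_gt_0_iff)
    qed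
    then show ?thesis by (simp add: garding_cone_def)
  qed
  then have "(\<chi> i. 1) \<in> \<Gamma>" using assms by (auto simp: symmetric_cone_def)
  then have "0 \<in> ?S" by (auto simp: pos intro!: exI[of _ "\<chi> i::'n. 1"])
  moreover have notin: "CARD('n) \<notin> ?S"
  proof
    assume "CARD('n) \<in> ?S"
    then obtain a :: "real^'n::{finite,linorder}" where a: "\<And>i. a $ i > 0"
      "(\<chi> i. if position i \<le> CARD('n) then - a $ i else a $ i) \<in> \<Gamma>" by blast
    have "position i \<le> CARD('n)" for i :: 'n unfolding position_def by (rule card_mono) auto
    then have "(\<chi> i. - a $ i) \<in> \<Gamma>" using a(2) by simp
    from trace[OF this] show False using a(1) sum_nonneg[of UNIV "($) a"]
      by (simp add: sum_negf less_imp_le not_less)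
  qed
  moreover have "finite ?S" by (rule finite_subset[of _ "{..CARD('n)}"]) auto
  then have in_S: "kappa \<Gamma> \<in> ?S" using \<open>0 \<in> ?S\<close> unfolding kappa_def by (intro Max_in) blast+
  have "kappa \<Gamma> \<noteq> CARD('n)"
  proof
    assume "kappa \<Gamma> = CARD('n)"
    with in_S have "CARD('n) \<in> ?S" by (simp only:)
    with notin show False by (rule notE)
  qed
  moreover have "kappa \<Gamma> \<le> CARD('n)" using in_S by (simp only: mem_Collect_eq)
  ultimately show ?thesis by (simp only: le_neq_implies_less)
qed

text \<open>Positive and homogeneous of degree one, \<open>f\<close> grows linearly along rays, so the ellipticity constant applies to \<open>f\<close> itself.\<close>

lemma curvature_function_ray_limit:
  assumes "curvature_function \<Gamma> f"
  shows "ray_limit_condition \<Gamma> f"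
  unfolding ray_limit_condition_def
proof (intro ballI allI impI exI conjI)
  fix l \<sigma> assume l: "l \<in> \<Gamma>"
  have pos: "f l > 0" using assms l by (simp add: curvature_function_def)
  have "filterlim (\<lambda>t. t * f l) at_top at_top"
    using pos by (intro filterlim_tendsto_pos_mult_at_top[OF tendsto_const _ filterlim_ident, THEN filterlim_cong[THEN iffD1, rotated -1]])
      (auto simp: mult.commute)
  then have "((\<lambda>t. ereal (t * f l)) \<longlongrightarrow> \<infinity>) at_top"
    by (simp add: tendsto_PInfty_eq_at_top)
  moreover have "\<forall>\<^sub>F t in at_top. ereal (t * f l) = ereal (f (t *\<^sub>R l))"
    using eventually_gt_at_top[of "0::real"]
    by eventually_elim (use assms l in \<open>simp add: curvature_function_def\<close>)
  ultimately show "((\<lambda>t. ereal (f (t *\<^sub>R l))) \<longlongrightarrow> \<infinity>) at_top"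
    using tendsto_cong by fastforce
qed simp

text \<open>Apart from \<open>i\<close>, at least \<open>\<kappa>\<close> of the first \<open>\<kappa> + 1\<close> indices remain, and each of their partial derivatives is at
  least the fraction \<open>\<theta>\<close> of the total.\<close>

lemma partial_upper_bound:
  fixes \<Gamma> :: "(real^'n::{finite,linorder}) set"
  assumes cone: "symmetric_cone \<Gamma>" and f: "curvature_function \<Gamma> f"
    and theta: "ellipticity_constant \<Gamma> \<theta>"
    and b: "b \<in> \<Gamma>" "\<And>i j. i \<le> j \<Longrightarrow> b $ i \<le> b $ j"
  shows "partial i f b \<le> (1 - real (kappa \<Gamma>) * \<theta>) * (\<Sum>j\<in>UNIV. partial j f b)"
proof -
  let ?s = "\<Sum>j\<in>UNIV. partial j f b"
  let ?J = "{j. position j \<le> kappa \<Gamma> + 1} - {i}"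
  have pos: "partial j f b > 0" for j
    using f b(1) by (simp add: curvature_function_def elliptic_concave_def)
  have low: "partial j f b \<ge> \<theta> * ?s" if "position j \<le> kappa \<Gamma> + 1" for j
    using theta f b that curvature_function_ray_limit[OF f]
    by (auto simp: ellipticity_constant_def curvature_function_def)
  have "kappa \<Gamma> \<le> card ?J"
    using card_position_le[where 'n='n, of "kappa \<Gamma> + 1"] kappa_less_dim[OF cone]
      diff_card_le_card_Diff[of "{i}" "{j. position j \<le> kappa \<Gamma> + 1}"] by simp
  moreover have "0 \<le> \<theta> * ?s"
    using theta pos by (intro mult_nonneg_nonneg sum_nonneg) (auto simp: ellipticity_constant_def less_imp_le)
  ultimately have "real (kappa \<Gamma>) * (\<theta> * ?s) \<le> real (card ?J) * (\<theta> * ?s)"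
    by (intro mult_right_mono) auto
  also have "\<dots> \<le> (\<Sum>j\<in>?J. partial j f b)"
    using low by (intro sum_bounded_below) auto
  also have "\<dots> \<le> (\<Sum>j\<in>UNIV - {i}. partial j f b)"
    using pos by (intro sum_mono2) (auto simp: less_imp_le)
  also have "\<dots> = ?s - partial i f b" by (simp add: sum_diff1)
  finally show ?thesis by (simp add: algebra_simps)
qed

text \<open>Here \<open>b\<close> and \<open>l\<close> are eigenvalues of the Schouten tensors of the upper and the lower function, and \<open>w\<close> is the diagonal
  of the Hessian of their difference, in an orthonormal frame diagonalizing the first tensor. The assumptions on \<open>\<tau>\<close>
  enter exactly in the sign of the sum of \<open>f\<^sub>i\<close> times the difference of the two diagonals.\<close>

lemma comparison_of_eigenvalues:
  fixes \<Gamma> :: "(real^'n::{finite,linorder}) set" and f :: "real^'n::{finite,linorder} \<Rightarrow> real"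
  assumes dim: "CARD('n) \<ge> 3" and cone: "symmetric_cone \<Gamma>" and f: "curvature_function \<Gamma> f"
    and theta: "ellipticity_constant \<Gamma> \<theta>"
    and alpha: "\<alpha> = 1 \<or> \<alpha> = -1" and tau_neg: "\<alpha> = -1 \<Longrightarrow> \<tau> < 1"
    and tau_pos: "\<alpha> = 1 \<Longrightarrow> \<tau> > 1 + (real CARD('n) - 2) * (1 - real (kappa \<Gamma>) * \<theta>)"
    and b: "b \<in> \<Gamma>" and l: "l \<in> \<Gamma>"
    and P: "\<And>i j. P i j \<ge> 0" "\<And>i. (\<Sum>j\<in>UNIV. P i j) = 1" "\<And>j. (\<Sum>i\<in>UNIV. P i j) = 1"
    and w: "\<And>i. w i \<ge> 0"
    and eq: "\<And>i. b $ i = (\<Sum>j\<in>UNIV. P i j * l $ j)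
      + \<alpha> * ((\<tau> - 1) / (real CARD('n) - 2) * (\<Sum>j\<in>UNIV. w j) - w i)"
  shows "f l \<le> f b"
proof -
  have ec: "elliptic_concave \<Gamma> f" using f by (simp add: curvature_function_def)
  obtain \<pi> :: "'n \<Rightarrow> 'n"
    where \<pi>: "bij \<pi>" "\<And>i j. i \<le> j \<Longrightarrow> b $ \<pi> i \<le> b $ \<pi> j"
    by (rule permutation_to_increasing[of b]) (rule that)
  have reindex: "(\<Sum>j\<in>UNIV. h (\<pi> j)) = (\<Sum>j\<in>UNIV. h j)" for h :: "'n \<Rightarrow> real"
    using \<pi>(1) by (rule sum.reindex_bij_betw)
  define c where "c = (\<chi> i. b $ \<pi> i)"
  have c: "c \<in> \<Gamma>" "f c = f b" "\<And>i j. i \<le> j \<Longrightarrow> c $ i \<le> c $ j"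
    using permuted_in_cone[OF cone ec b \<pi>(1)] \<pi>(2) by (auto simp: c_def)
  define a where "a i = partial i f c" for i
  have a: "a i > 0" for i using ec c(1) by (simp add: a_def elliptic_concave_def)
  define t where "t = (\<tau> - 1) / (real CARD('n) - 2)"
  define W where "W = (\<Sum>j\<in>UNIV. w j)"
  have W: "W \<ge> 0" using w by (simp add: W_def sum_nonneg)
  have n: "real CARD('n) - 2 > 0" using dim by linarith
  have "0 \<le> (\<Sum>i\<in>UNIV. a i * (\<alpha> * (t * W - w (\<pi> i))))"
  proof (cases "\<alpha> = 1")
    case True
    let ?k = "1 - real (kappa \<Gamma>) * \<theta>"
    have "(\<Sum>i\<in>UNIV. a i * w (\<pi> i)) \<le> (\<Sum>i\<in>UNIV. (?k * sum a UNIV) * w (\<pi> i))"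
      using partial_upper_bound[OF cone f theta c(1,3)] w
      by (intro sum_mono mult_right_mono) (auto simp: a_def)
    also have "\<dots> = ?k * (sum a UNIV * W)"
      by (simp add: sum_distrib_left[symmetric] reindex W_def)
    also have "\<dots> \<le> t * (sum a UNIV * W)"
    proof (rule mult_right_mono)
      show "?k \<le> t" using tau_pos[OF True] n by (simp add: t_def field_simps)
      show "0 \<le> sum a UNIV * W" using W a by (simp add: sum_nonneg less_imp_le)
    qed
    also have "\<dots> = (\<Sum>i\<in>UNIV. a i * (t * W))"
      by (simp add: sum_distrib_left sum_distrib_right mult_ac)
    finally show ?thesis
      by (simp add: True right_diff_distrib sum_subtractf)
  next
    case False
    then have al: "\<alpha> = -1" using alpha by simp
    have "t \<le> 0" using tau_neg[OF al] n by (simp add: t_def divide_nonpos_pos)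
    then have "t * W \<le> 0" using W by (simp add: mult_nonpos_nonneg)
    then have nonneg: "0 \<le> \<alpha> * (t * W - w i)" for i using w[of i] al by simp
    show ?thesis
      by (rule sum_nonneg) (rule mult_nonneg_nonneg[OF less_imp_le[OF a] nonneg])
  qed
  then have "0 \<le> (\<Sum>i\<in>UNIV. partial i f c * (c $ i - (\<Sum>j\<in>UNIV. P (\<pi> i) j * l $ j)))"
    by (simp add: a_def c_def eq t_def W_def)
  from comparison_by_gradient[OF cone ec c(1,3) l, of "\<lambda>i. P (\<pi> i)", OF _ _ _ _ this]
  show ?thesis using P reindex[of "\<lambda>i. P i _"] c(2) by auto
qed

section \<open>Curvature under a conformal change at a critical point\<close>

lemma differentiable_prod_real:
  fixes F :: "'i \<Rightarrow> 'a::real_normed_vector \<Rightarrow> real"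
  shows "(\<And>k. k \<in> K \<Longrightarrow> F k differentiable (at x)) \<Longrightarrow> (\<lambda>y. \<Prod>k\<in>K. F k y) differentiable (at x)"
  by (induction K rule: infinite_finite_induct) auto

lemma differentiable_det:
  fixes A :: "'a::real_normed_vector \<Rightarrow> real^'n^'n"
  assumes "\<And>i j. (\<lambda>y. A y $ i $ j) differentiable (at x)"
  shows "(\<lambda>y. det (A y)) differentiable (at x)"
  unfolding det_def
  by (intro differentiable_sum differentiable_mult differentiable_const differentiable_prod_real ballI assms)
    (auto simp: finite_permutations)

text \<open>Cramer's rule exhibits the inverse as a rational function of the entries, so that it inherits their differentiability.\<close>

lemma matrix_inv_entry:
  fixes A :: "real^'n^'n"
  assumes "A ** B = mat 1"
  shows "B $ k $ j = det (\<chi> i l. if l = k then axis j 1 $ i else A $ i $ l) / det A"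
proof -
  have "invertible A" using assms invertible_right_inverse by blast
  then have "det A \<noteq> 0" using invertible_det_nz by blast
  moreover have "A *v column j B = axis j 1"
    by (metis assms matrix_vector_mul_assoc matrix_vector_mul_lid matrix_vector_mult_basis)
  ultimately have "column j B = (\<chi> k. det (\<chi> i l. if l = k then axis j 1 $ i else A $ i $ l) / det A)"
    by (simp add: cramer)
  then show ?thesis by (simp add: column_def vec_eq_iff)
qed

lemma positive_matrix_inverse:
  fixes G :: "real^'n^'n"
  assumes "transpose G = G" "\<And>v. v \<noteq> 0 \<Longrightarrow> v \<bullet> (G *v v) > 0"
  shows "G ** matrix_inv G = mat 1" "matrix_inv G ** G = mat 1"
    "transpose (matrix_inv G) = matrix_inv G"
proof -
  obtain Q :: "real^'n^'n" and d
    where Q: "transpose Q ** G ** Q = mat 1" "transpose Q ** G ** Q = diagonal d"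
    using simultaneous_diagonalization[OF assms assms(1)] by blast
  note Q' = congruence_to_identity[OF Q(1)]
  show "G ** matrix_inv G = mat 1" using Q' by (simp add: matrix_mul_assoc)
  show "matrix_inv G ** G = mat 1" using Q' by (simp add: matrix_mul_assoc)
  show "transpose (matrix_inv G) = matrix_inv G" using Q' by (simp add: matrix_transpose_mul)
qed

lemma matrix_inv_exp_scaleR:
  fixes A :: "real^'n^'n"
  assumes "A ** matrix_inv A = mat 1"
  shows "matrix_inv (exp (2 * t) *\<^sub>R A) = exp (- 2 * t) *\<^sub>R matrix_inv A"
proof (rule matrix_inv_unique)
  have "(exp (2 * t) *\<^sub>R A) ** (exp (- 2 * t) *\<^sub>R matrix_inv A)
      = (exp (2 * t) * exp (- 2 * t)) *\<^sub>R (A ** matrix_inv A)"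
    by (simp add: vec_eq_iff matrix_matrix_mult_def sum_distrib_left mult_ac)
  then show "(exp (2 * t) *\<^sub>R A) ** (exp (- 2 * t) *\<^sub>R matrix_inv A) = mat 1"
    using assms by (simp add: exp_add[symmetric])
qed

lemma symmetric_matrix_entry:
  assumes "transpose A = A"
  shows "A $ i $ j = A $ j $ i"
proof -
  have "transpose A $ i $ j = A $ j $ i" by (simp add: transpose_def)
  then show ?thesis unfolding assms .
qed

text \<open>A Riemannian metric in the coordinates of a chart; \<open>H y\<close> is the matrix of its coefficients at \<open>y\<close>.\<close>

locale local_metric =
  fixes S :: "(real^'n::finite) set" and H :: "real^'n \<Rightarrow> real^'n^'n"
  assumes open_S: "open S"
    and smooth: "\<And>i j. smooth_on S (\<lambda>y. H y $ i $ j)"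
    and symmetric: "\<And>y. y \<in> S \<Longrightarrow> transpose (H y) = H y"
    and positive: "\<And>y v. y \<in> S \<Longrightarrow> v \<noteq> 0 \<Longrightarrow> v \<bullet> (H y *v v) > 0"
begin

abbreviation N :: "real^'n \<Rightarrow> real^'n^'n" where
  "N y \<equiv> matrix_inv (H y)"

lemma H_sym: "y \<in> S \<Longrightarrow> H y $ i $ j = H y $ j $ i"
  by (rule symmetric_matrix_entry[OF symmetric])

lemma inverse_matrix:
  assumes "y \<in> S"
  shows "H y ** N y = mat 1" "N y ** H y = mat 1"
  using positive_matrix_inverse[OF symmetric positive] assms by blast+

lemma N_sym:
  assumes "y \<in> S"
  shows "N y $ i $ j = N y $ j $ i"
proof -
  have "transpose (N y) = N y"
    using positive_matrix_inverse(3)[OF symmetric positive] assms by blast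
  then show ?thesis by (rule symmetric_matrix_entry)
qed

lemma sum_N_H:
  assumes "y \<in> S"
  shows "(\<Sum>m\<in>UNIV. N y $ l $ m * H y $ m $ j) = (if l = j then 1 else 0)"
  using inverse_matrix(2)[OF assms] by (simp add: vec_eq_iff matrix_matrix_mult_def mat_def)

lemma differentiable_H: "x \<in> S \<Longrightarrow> (\<lambda>y. H y $ i $ j) differentiable (at x)"
  using smooth smooth_on_differentiable by blast

lemma differentiable_partial_H: "x \<in> S \<Longrightarrow> partial k (\<lambda>y. H y $ i $ j) differentiable (at x)"
  using smooth smooth_on_differentiable smooth_on_partial by blast

lemma differentiable_N:
  assumes x: "x \<in> S"
  shows "(\<lambda>y. N y $ k $ j) differentiable (at x)"
proof (rule differentiable_cong_open[OF _ open_S x])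
  let ?M = "\<lambda>y. \<chi> i l. if l = k then axis j 1 $ i else H y $ i $ l"
  have "det (H x) \<noteq> 0"
    using inverse_matrix(1)[OF x] invertible_det_nz invertible_right_inverse by blast
  moreover have "(\<lambda>y. det (?M y)) differentiable (at x)"
  proof (rule differentiable_det)
    fix i l
    show "(\<lambda>y. ?M y $ i $ l) differentiable (at x)"
      using differentiable_H[OF x] by (cases "l = k") simp_all
  qed
  ultimately show "(\<lambda>y. det (?M y) / det (H y)) differentiable (at x)"
    using differentiable_det differentiable_H[OF x] by (intro differentiable_divide) auto
  show "det (?M y) / det (H y) = N y $ k $ j" if "y \<in> S" for y
    using matrix_inv_entry[OF inverse_matrix(1)[OF that]] by simp
qed

lemma differentiable_christoffel:
  assumes x: "x \<in> S"
  shows "christoffel H l i j differentiable (at x)"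
proof -
  have "(\<lambda>x. (\<Sum>m\<in>UNIV. N x $ l $ m *
     (partial i (\<lambda>y. H y $ j $ m) x + partial j (\<lambda>y. H y $ i $ m) x
       - partial m (\<lambda>y. H y $ i $ j) x)) / 2) differentiable (at x)"
    by (intro differentiable_divide differentiable_sum ballI differentiable_mult differentiable_add
        differentiable_diff differentiable_N differentiable_partial_H differentiable_const x finite) simp_all
  then show ?thesis by (simp add: christoffel_def[abs_def])
qed

lemma christoffel_sym:
  assumes "y \<in> S"
  shows "christoffel H l i j y = christoffel H l j i y"
proof -
  have "partial m (\<lambda>y. H y $ i $ j) y = partial m (\<lambda>y. H y $ j $ i) y" for m
    using H_sym by (intro partial_cong_open[OF open_S assms])
  then show ?thesis by (simp add: christoffel_def add.commute)
qed

text \<open>In \<open>\<partial>\<^sub>i(e\<^bsup>2w\<^esup> H\<^sub>j\<^sub>m) = e\<^bsup>2w\<^esup> (2 w\<^sub>i H\<^sub>j\<^sub>m + \<partial>\<^sub>i H\<^sub>j\<^sub>m)\<close> the factor \<open>e\<^bsup>2w\<^esup>\<close> cancels against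
  the inverse metric, and contracting \<open>H\<close> with its inverse leaves Kronecker symbols.\<close>

lemma christoffel_conformal:
  assumes y: "y \<in> S" and w: "w differentiable (at y)"
  shows "christoffel (\<lambda>z. exp (2 * w z) *\<^sub>R H z) l i j y = christoffel H l i j y
    + (if l = i then partial j w y else 0) + (if l = j then partial i w y else 0)
    - H y $ i $ j * (\<Sum>m\<in>UNIV. N y $ l $ m * partial m w y)"
proof -
  let ?e = "exp (2 * w y)"
  have inv: "matrix_inv (?e *\<^sub>R H y) = exp (- 2 * w y) *\<^sub>R N y"
    by (rule matrix_inv_exp_scaleR[OF inverse_matrix(1)[OF y]])
  have D: "partial k (\<lambda>z. (exp (2 * w z) *\<^sub>R H z) $ a $ b) y =
      ?e * (2 * partial k w y * H y $ a $ b + partial k (\<lambda>z. H z $ a $ b) y)" for k a b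
  proof -
    have "partial k (\<lambda>z. (exp (2 * w z) *\<^sub>R H z) $ a $ b) y = partial k (\<lambda>z. exp (2 * w z) * H z $ a $ b) y"
      by simp
    also have "\<dots> = partial k (\<lambda>z. exp (2 * w z)) y * H y $ a $ b + ?e * partial k (\<lambda>z. H z $ a $ b) y"
      using w differentiable_H[OF y] by (intro partial_mult differentiable_exp_comp) auto
    also have "partial k (\<lambda>z. exp (2 * w z)) y = ?e * (2 * partial k w y)"
      using w by (subst partial_exp) (auto simp: partial_cmult)
    finally show ?thesis by (simp add: algebra_simps)
  qed
  let ?h = "\<lambda>m. partial i (\<lambda>z. H z $ j $ m) y + partial j (\<lambda>z. H z $ i $ m) y - partial m (\<lambda>z. H z $ i $ j) y"
  let ?n = "\<lambda>m. N y $ l $ m"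
  have summand: "(exp (- 2 * w y) *\<^sub>R N y) $ l $ m *
      (?e * (2 * partial i w y * H y $ j $ m + partial i (\<lambda>z. H z $ j $ m) y)
       + ?e * (2 * partial j w y * H y $ i $ m + partial j (\<lambda>z. H z $ i $ m) y)
       - ?e * (2 * partial m w y * H y $ i $ j + partial m (\<lambda>z. H z $ i $ j) y))
    = ?n m * ?h m + 2 * (partial i w y * (?n m * H y $ m $ j) + partial j w y * (?n m * H y $ m $ i)
       - H y $ i $ j * (?n m * partial m w y))" for m
  proof -
    have "exp (- 2 * w y) * ?e = 1" by (simp add: exp_add[symmetric])
    then have cancel: "(exp (- 2 * w y) * r) * (?e * p + ?e * q - ?e * s) = r * (p + q - s)" for r p q s :: real
      by (metis (no_types, opaque_lifting) distrib_left mult.assoc mult.commute mult.left_neutral right_diff_distrib)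
    have comp: "(exp (- 2 * w y) *\<^sub>R N y) $ l $ m = exp (- 2 * w y) * ?n m" by simp
    show ?thesis
      unfolding comp cancel H_sym[OF y, of j m] H_sym[OF y, of i m] by (simp add: algebra_simps)
  qed
  have "christoffel (\<lambda>z. exp (2 * w z) *\<^sub>R H z) l i j y =
      (\<Sum>m\<in>UNIV. ?n m * ?h m + 2 * (partial i w y * (?n m * H y $ m $ j) + partial j w y * (?n m * H y $ m $ i)
       - H y $ i $ j * (?n m * partial m w y))) / 2"
    unfolding christoffel_def inv D summand ..
  also have "\<dots> = (\<Sum>m\<in>UNIV. ?n m * ?h m) / 2
     + (partial i w y * (\<Sum>m\<in>UNIV. ?n m * H y $ m $ j) + partial j w y * (\<Sum>m\<in>UNIV. ?n m * H y $ m $ i)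
       - H y $ i $ j * (\<Sum>m\<in>UNIV. ?n m * partial m w y))"
    by (simp add: sum.distrib sum_subtractf sum_distrib_left[symmetric] add_divide_distrib)
  finally show ?thesis
    unfolding sum_N_H[OF y] by (simp add: christoffel_def)
qed

context
  fixes w :: "real^'n \<Rightarrow> real" and x
  assumes w: "smooth_on S w" and x: "x \<in> S" and crit: "\<And>i. partial i w x = 0"
begin

abbreviation W :: "'n \<Rightarrow> 'n \<Rightarrow> real" where
  "W i j \<equiv> partial i (partial j w) x"

lemma W_sym: "W i j = W j i"
  by (rule partial_commute[OF w open_S x])

text \<open>The conformal correction of the Christoffel symbols is linear in \<open>dw\<close>. At a zero of \<open>dw\<close> only the terms in which the
  derivative hits \<open>dw\<close> survive.\<close>

lemma partial_christoffel_conformal: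
  "partial k (christoffel (\<lambda>z. exp (2 * w z) *\<^sub>R H z) l i j) x = partial k (christoffel H l i j) x
    + (if l = i then W k j else 0) + (if l = j then W k i else 0)
    - H x $ i $ j * (\<Sum>m\<in>UNIV. N x $ l $ m * W k m)"
proof -
  have dw: "partial m w differentiable (at x)" for m
    using w x smooth_on_differentiable smooth_on_partial by blast
  let ?T = "\<lambda>y. \<Sum>m\<in>UNIV. N y $ l $ m * partial m w y"
  let ?I = "\<lambda>a b y. if l = a then partial b w y else 0"
  have dI: "?I a b differentiable (at x)" "partial k (?I a b) x = (if l = a then W k b else 0)" for a b
    using dw by (cases "l = a"; simp add: partial_const)+
  have dT: "?T differentiable (at x)"
    using dw differentiable_N[OF x] by auto
  have pT: "partial k ?T x = (\<Sum>m\<in>UNIV. N x $ l $ m * W k m)"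
    using dw differentiable_N[OF x] by (simp add: partial_sum partial_mult crit)
  have "partial k (christoffel (\<lambda>z. exp (2 * w z) *\<^sub>R H z) l i j) x
    = partial k (\<lambda>y. christoffel H l i j y + ?I i j y + ?I j i y - H y $ i $ j * ?T y) x"
    by (rule partial_cong_open[OF open_S x], rule christoffel_conformal)
      (use w smooth_on_differentiable in blast)+
  also have "\<dots> = partial k (christoffel H l i j) x + partial k (?I i j) x + partial k (?I j i) x
      - (partial k (\<lambda>y. H y $ i $ j) x * ?T x + H x $ i $ j * partial k ?T x)"
    using differentiable_christoffel[OF x] dI(1) dT differentiable_H[OF x]
    by (simp only: partial_diff partial_add partial_mult differentiable_add differentiable_mult)
  finally show ?thesis by (simp add: dI(2) pT crit)
qed

text \<open>At the critical point the Christoffel symbols of both metrics agree, so only their derivatives contribute, and tracing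
  these gives \<open>W\<^sub>j\<^sub>k\<close> the total coefficient \<open>1 + 1 - n - 1 + 1 = 2 - n\<close>.\<close>

lemma ricci_conformal_at_critical_point:
  "(\<Sum>i\<in>UNIV. riemann (\<lambda>z. exp (2 * w z) *\<^sub>R H z) i i j k x) = (\<Sum>i\<in>UNIV. riemann H i i j k x)
    - (real CARD('n) - 2) * W j k - (\<Sum>i\<in>UNIV. \<Sum>m\<in>UNIV. N x $ i $ m * W i m) * H x $ j $ k"
proof -
  have chr: "christoffel (\<lambda>z. exp (2 * w z) *\<^sub>R H z) l i j x = christoffel H l i j x" for l i j
    using christoffel_conformal[OF x smooth_on_differentiable[OF w x]] by (simp add: crit)
  have "riemann (\<lambda>z. exp (2 * w z) *\<^sub>R H z) i i j k x - riemann H i i j k x =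
      ((if i = j then W i k else 0) + (if i = k then W i j else 0)
        - H x $ j $ k * (\<Sum>m\<in>UNIV. N x $ i $ m * W i m))
      - (W j k + (if i = k then W j i else 0) - H x $ i $ k * (\<Sum>m\<in>UNIV. N x $ i $ m * W j m))" for i
    unfolding riemann_def chr partial_christoffel_conformal by simp
  then have "(\<Sum>i\<in>UNIV. riemann (\<lambda>z. exp (2 * w z) *\<^sub>R H z) i i j k x) - (\<Sum>i\<in>UNIV. riemann H i i j k x)
     = (\<Sum>i\<in>UNIV. ((if i = j then W i k else 0) + (if i = k then W i j else 0)
        - H x $ j $ k * (\<Sum>m\<in>UNIV. N x $ i $ m * W i m))
      - (W j k + (if i = k then W j i else 0) - H x $ i $ k * (\<Sum>m\<in>UNIV. N x $ i $ m * W j m)))"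
    by (simp only: sum_subtractf[symmetric])
  also have "\<dots> = W j k + W k j - H x $ j $ k * (\<Sum>i\<in>UNIV. \<Sum>m\<in>UNIV. N x $ i $ m * W i m)
      - (real CARD('n) * W j k + W j k - (\<Sum>i\<in>UNIV. H x $ i $ k * (\<Sum>m\<in>UNIV. N x $ i $ m * W j m)))"
    by (simp add: sum.distrib sum_subtractf sum_distrib_left[symmetric])
  also have "(\<Sum>i\<in>UNIV. H x $ i $ k * (\<Sum>m\<in>UNIV. N x $ i $ m * W j m)) = W j k"
  proof -
    have "(\<Sum>i\<in>UNIV. H x $ i $ k * (\<Sum>m\<in>UNIV. N x $ i $ m * W j m))
        = (\<Sum>m\<in>UNIV. (\<Sum>i\<in>UNIV. N x $ m $ i * H x $ i $ k) * W j m)"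
      by (simp add: sum_distrib_left sum_distrib_right mult_ac N_sym[OF x])
        (subst sum.swap, simp add: N_sym[OF x] mult_ac)
    then show ?thesis unfolding sum_N_H[OF x] by (simp add: if_distrib[of "\<lambda>x. x * _"] cong: if_cong)
  qed
  finally show ?thesis by (simp add: W_sym[of k j] algebra_simps)
qed

end

text \<open>This trace is \<open>\<partial>\<^sub>k\<close> of half the logarithm of \<open>det H\<close>, written without the determinant: the other two
  terms of the Christoffel symbol cancel because the inverse metric is symmetric.\<close>

lemma contracted_christoffel:
  assumes "y \<in> S"
  shows "(\<Sum>i\<in>UNIV. christoffel H i i k y)
    = (\<Sum>i\<in>UNIV. \<Sum>m\<in>UNIV. N y $ i $ m * partial k (\<lambda>z. H z $ m $ i) y) / 2"
proof -
  have pH: "partial a (\<lambda>z. H z $ b $ c) y = partial a (\<lambda>z. H z $ c $ b) y" for a b c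
    using H_sym by (intro partial_cong_open[OF open_S assms])
  have "(\<Sum>i\<in>UNIV. \<Sum>m\<in>UNIV. N y $ i $ m * partial i (\<lambda>z. H z $ k $ m) y)
      = (\<Sum>m\<in>UNIV. \<Sum>i\<in>UNIV. N y $ i $ m * partial i (\<lambda>z. H z $ k $ m) y)"
    by (rule sum.swap)
  also have "\<dots> = (\<Sum>i\<in>UNIV. \<Sum>m\<in>UNIV. N y $ i $ m * partial m (\<lambda>z. H z $ i $ k) y)"
    by (intro sum.cong refl) (metis N_sym[OF assms] pH)
  finally have cancel: "(\<Sum>i\<in>UNIV. \<Sum>m\<in>UNIV. N y $ i $ m * partial i (\<lambda>z. H z $ k $ m) y)
      = (\<Sum>i\<in>UNIV. \<Sum>m\<in>UNIV. N y $ i $ m * partial m (\<lambda>z. H z $ i $ k) y)" .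
  have "(\<Sum>i\<in>UNIV. christoffel H i i k y) = (\<Sum>i\<in>UNIV. \<Sum>m\<in>UNIV. N y $ i $ m *
      (partial i (\<lambda>z. H z $ k $ m) y + partial k (\<lambda>z. H z $ i $ m) y - partial m (\<lambda>z. H z $ i $ k) y)) / 2"
    by (simp add: christoffel_def sum_divide_distrib)
  also have "\<dots> = (\<Sum>i\<in>UNIV. \<Sum>m\<in>UNIV. N y $ i $ m * partial k (\<lambda>z. H z $ i $ m) y) / 2"
    using cancel by (simp add: distrib_left right_diff_distrib sum.distrib sum_subtractf)
  finally show ?thesis by (simp only: pH[of k])
qed

text \<open>Differentiate \<open>N H = 1\<close>.\<close>

lemma partial_N:
  assumes x: "x \<in> S"
  shows "(\<chi> a b. partial k (\<lambda>y. N y $ a $ b) x)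
    = - (N x ** (\<chi> a b. partial k (\<lambda>y. H y $ a $ b) x) ** N x)"
proof -
  let ?DN = "\<chi> a b. partial k (\<lambda>y. N y $ a $ b) x" and ?DH = "\<chi> a b. partial k (\<lambda>y. H y $ a $ b) x"
  have "?DN ** H x + N x ** ?DH = 0"
  proof -
    have "(\<Sum>m\<in>UNIV. partial k (\<lambda>y. N y $ l $ m) x * H x $ m $ j + N x $ l $ m * partial k (\<lambda>y. H y $ m $ j) x) = 0" for l j
    proof -
      have "partial k (\<lambda>y. \<Sum>m\<in>UNIV. N y $ l $ m * H y $ m $ j) x = partial k (\<lambda>y. if l = j then 1 else 0) x"
        using sum_N_H by (intro partial_cong_open[OF open_S x])
      then show ?thesis
        using differentiable_N[OF x] differentiable_H[OF x] by (simp add: partial_const partial_sum partial_mult)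
    qed
    then show ?thesis by (simp add: vec_eq_iff matrix_matrix_mult_def sum.distrib)
  qed
  then have "?DN ** H x = - (N x ** ?DH)" by (rule eq_neg_iff_add_eq_0[THEN iffD2])
  then have "(?DN ** H x) ** N x = - (N x ** ?DH) ** N x" by (simp only:)
  moreover have "- (N x ** ?DH) ** N x = - (N x ** ?DH ** N x)"
    by (simp add: vec_eq_iff matrix_matrix_mult_def sum_negf)
  ultimately show ?thesis
    using inverse_matrix(1)[OF x] by (simp add: matrix_mul_assoc[symmetric])
qed

text \<open>This is the equality of the mixed second derivatives of the logarithm of \<open>det H\<close>. It is read off from the symmetric
  expression \<open>- tr (N \<partial>\<^sub>jH N \<partial>\<^sub>kH) + tr (N \<partial>\<^sub>j\<partial>\<^sub>kH)\<close>.\<close>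

lemma partial_contracted_christoffel_sym:
  assumes x: "x \<in> S"
  shows "(\<Sum>i\<in>UNIV. partial j (christoffel H i i k) x) = (\<Sum>i\<in>UNIV. partial k (christoffel H i i j) x)"
proof -
  let ?D = "\<lambda>k. \<chi> a b. partial k (\<lambda>y. H y $ a $ b) x"
  have formula: "(\<Sum>i\<in>UNIV. partial j (christoffel H i i k) x)
    = (- trace (N x ** ?D j ** N x ** ?D k)
      + (\<Sum>i\<in>UNIV. \<Sum>m\<in>UNIV. N x $ i $ m * partial j (partial k (\<lambda>z. H z $ m $ i)) x)) / 2" for j k
  proof -
    have "(\<Sum>i\<in>UNIV. partial j (christoffel H i i k) x) = partial j (\<lambda>y. \<Sum>i\<in>UNIV. christoffel H i i k y) x"
      using differentiable_christoffel[OF x] by (simp add: partial_sum)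
    also have "\<dots> = partial j (\<lambda>y. 1/2 * (\<Sum>i\<in>UNIV. \<Sum>m\<in>UNIV. N y $ i $ m * partial k (\<lambda>z. H z $ m $ i) y)) x"
      using contracted_christoffel by (intro partial_cong_open[OF open_S x]) simp
    also have "\<dots> = 1/2 * (\<Sum>i\<in>UNIV. \<Sum>m\<in>UNIV. partial j (\<lambda>y. N y $ i $ m) x * partial k (\<lambda>z. H z $ m $ i) x
        + N x $ i $ m * partial j (partial k (\<lambda>z. H z $ m $ i)) x)"
    proof -
      let ?t = "\<lambda>i m y. N y $ i $ m * partial k (\<lambda>z. H z $ m $ i) y"
      have D: "?t i m differentiable (at x)" for i m
        by (rule differentiable_mult[OF differentiable_N[OF x] differentiable_partial_H[OF x]])
      have D': "(\<lambda>y. \<Sum>m\<in>UNIV. ?t i m y) differentiable (at x)" for i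
        using D by (intro differentiable_sum) auto
      have "partial j (\<lambda>y. 1/2 * (\<Sum>i\<in>UNIV. \<Sum>m\<in>UNIV. ?t i m y)) x
          = 1/2 * partial j (\<lambda>y. \<Sum>i\<in>UNIV. \<Sum>m\<in>UNIV. ?t i m y) x"
        using D' by (intro partial_cmult differentiable_sum) auto
      also have "partial j (\<lambda>y. \<Sum>i\<in>UNIV. \<Sum>m\<in>UNIV. ?t i m y) x
          = (\<Sum>i\<in>UNIV. partial j (\<lambda>y. \<Sum>m\<in>UNIV. ?t i m y) x)"
        by (rule partial_sum) (rule D')
      also have "\<dots> = (\<Sum>i\<in>UNIV. \<Sum>m\<in>UNIV. partial j (?t i m) x)"
        by (intro sum.cong refl partial_sum D)
      finally show ?thesis
        using partial_mult[OF differentiable_N[OF x] differentiable_partial_H[OF x]] by (simp only:)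
    qed
    also have "(\<Sum>i\<in>UNIV. \<Sum>m\<in>UNIV. partial j (\<lambda>y. N y $ i $ m) x * partial k (\<lambda>z. H z $ m $ i) x
        + N x $ i $ m * partial j (partial k (\<lambda>z. H z $ m $ i)) x)
      = trace ((\<chi> a b. partial j (\<lambda>y. N y $ a $ b) x) ** ?D k)
        + (\<Sum>i\<in>UNIV. \<Sum>m\<in>UNIV. N x $ i $ m * partial j (partial k (\<lambda>z. H z $ m $ i)) x)"
      by (simp add: trace_def matrix_matrix_mult_def sum.distrib)
    also have "trace ((\<chi> a b. partial j (\<lambda>y. N y $ a $ b) x) ** ?D k) = - trace (N x ** ?D j ** N x ** ?D k)"
      unfolding partial_N[OF x] by (simp add: trace_def matrix_matrix_mult_def sum_negf)
    finally show ?thesis by simp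
  qed
  have "trace (N x ** ?D j ** N x ** ?D k) = trace (N x ** ?D k ** N x ** ?D j)"
    using trace_mul_sym[of "N x ** ?D j" "N x ** ?D k"] by (simp add: matrix_mul_assoc)
  moreover have "partial j (partial k (\<lambda>z. H z $ m $ i)) x = partial k (partial j (\<lambda>z. H z $ m $ i)) x" for m i
    by (rule partial_commute[OF smooth open_S x])
  ultimately show ?thesis unfolding formula by simp
qed

text \<open>Of the four groups of terms of the Ricci tensor only the derivative of the contracted Christoffel symbol is not
  visibly symmetric. Symmetry is needed for the Schouten tensor to have real eigenvalues and an orthonormal eigenframe.\<close>

lemma ricci_sym:
  assumes x: "x \<in> S"
  shows "(\<Sum>i\<in>UNIV. riemann H i i j k x) = (\<Sum>i\<in>UNIV. riemann H i i k j x)"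
proof -
  let ?c = "\<lambda>l i j. christoffel H l i j x"
  have formula: "(\<Sum>i\<in>UNIV. riemann H i i j k x) =
    (\<Sum>i\<in>UNIV. partial i (christoffel H i j k) x) - (\<Sum>i\<in>UNIV. partial j (christoffel H i i k) x)
    + ((\<Sum>i\<in>UNIV. \<Sum>m\<in>UNIV. ?c i i m * ?c m j k) - (\<Sum>i\<in>UNIV. \<Sum>m\<in>UNIV. ?c i j m * ?c m i k))" for j k
    by (simp add: riemann_def sum.distrib sum_subtractf)
  have "(\<Sum>i\<in>UNIV. \<Sum>m\<in>UNIV. ?c i j m * ?c m i k) = (\<Sum>i\<in>UNIV. \<Sum>m\<in>UNIV. ?c i k m * ?c m i j)"
    by (subst sum.swap) (intro sum.cong refl, metis christoffel_sym[OF x] mult.commute)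
  moreover have "(\<Sum>i\<in>UNIV. \<Sum>m\<in>UNIV. ?c i i m * ?c m j k) = (\<Sum>i\<in>UNIV. \<Sum>m\<in>UNIV. ?c i i m * ?c m k j)"
    by (simp only: christoffel_sym[OF x, of _ j k])
  moreover have "partial i (christoffel H i j k) x = partial i (christoffel H i k j) x" for i
    using christoffel_sym by (intro partial_cong_open[OF open_S x])
  ultimately show ?thesis
    unfolding formula using partial_contracted_christoffel_sym[OF x, of j k] by simp
qed

end

section \<open>The Schouten tensor in a chart\<close>

lemma local_metric_conformal:
  assumes "local_metric S H" "smooth_on S w"
  shows "local_metric S (\<lambda>y. exp (2 * w y) *\<^sub>R H y)"
proof -
  interpret local_metric S H by fact
  show ?thesis
  proof
    show "smooth_on S (\<lambda>y. (exp (2 * w y) *\<^sub>R H y) $ i $ j)" for i j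
      using smooth_on_mult[OF open_S smooth_on_exp[OF open_S smooth_on_cmult[OF open_S assms(2)]] smooth]
      by simp
    show "transpose (exp (2 * w y) *\<^sub>R H y) = exp (2 * w y) *\<^sub>R H y" if "y \<in> S" for y
      using H_sym[OF that] by (simp add: vec_eq_iff transpose_def)
    show "v \<bullet> ((exp (2 * w y) *\<^sub>R H y) *v v) > 0" if "y \<in> S" "v \<noteq> 0" for y v
      using positive[OF that] by (simp add: scaleR_matrix_vector_assoc[symmetric])
  qed (rule open_S)
qed

lemma chart_inv_chart: "is_chart c \<Longrightarrow> q \<in> fst c \<Longrightarrow> chart_inv c (snd c q) = q"
  by (auto simp: is_chart_def homeomorphism_def)

lemma open_chart_image:
  assumes c: "is_chart c" and W: "open W"
  shows "open (snd c ` (fst c \<inter> W))"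
proof -
  have "continuous_on (snd c ` fst c) (chart_inv c)" "open (snd c ` fst c)"
    using c by (auto simp: is_chart_def homeomorphism_def)
  then have "open (snd c ` fst c \<inter> chart_inv c -` W)"
    using W continuous_on_open_vimage by (metis inf_commute)
  also have "snd c ` fst c \<inter> chart_inv c -` W = snd c ` (fst c \<inter> W)"
    using chart_inv_chart[OF c] by auto
  finally show ?thesis .
qed

lemma smooth_fun_on_continuous:
  fixes \<A> :: "('a::t2_space, 'n::finite) chart set"
  assumes A: "smooth_atlas \<A>" and v: "smooth_fun_on \<A> W v"
  shows "continuous_on W v"
proof -
  have "isCont v q" if q: "q \<in> W" for q
  proof -
    obtain c where c: "c \<in> \<A>" "q \<in> fst c" using A unfolding smooth_atlas_def by blast
    then have ch: "is_chart c" using A by (simp add: smooth_atlas_def)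
    have W: "open W" and sm: "smooth_on (snd c ` (fst c \<inter> W)) (v \<circ> chart_inv c)"
      using v c(1) by (auto simp: smooth_fun_on_def)
    have "continuous_on (snd c ` (fst c \<inter> W)) (v \<circ> chart_inv c)"
      by (rule smooth_on_continuous[OF sm])
    moreover have "continuous_on (fst c \<inter> W) (snd c)"
      using ch by (auto simp: is_chart_def homeomorphism_def intro: continuous_on_subset)
    ultimately have "continuous_on (fst c \<inter> W) ((v \<circ> chart_inv c) \<circ> snd c)"
      by (rule continuous_on_compose[rotated])
    then have "continuous_on (fst c \<inter> W) v"
      by (rule continuous_on_eq) (use chart_inv_chart[OF ch] in auto)
    moreover have "open (fst c \<inter> W)" using ch W by (auto simp: is_chart_def)
    ultimately show ?thesis using q c(2) continuous_on_eq_continuous_at by blast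
  qed
  then show ?thesis by (simp add: continuous_at_imp_continuous_on)
qed

lemma smooth_fun_on_subset:
  assumes "smooth_fun_on \<A> W v" "open V" "V \<subseteq> W"
  shows "smooth_fun_on \<A> V v"
  using assms smooth_on_subset unfolding smooth_fun_on_def by (metis Int_mono image_mono order_refl)

lemma smooth_fun_on_cong:
  assumes A: "smooth_atlas \<A>" and v: "smooth_fun_on \<A> W v" and eq: "\<And>q. q \<in> W \<Longrightarrow> v q = u q"
  shows "smooth_fun_on \<A> W u"
  unfolding smooth_fun_on_def
proof (intro conjI ballI)
  show W: "open W" using v by (simp add: smooth_fun_on_def)
  fix c assume c: "c \<in> \<A>"
  then have ch: "is_chart c" using A by (simp add: smooth_atlas_def)
  show "smooth_on (snd c ` (fst c \<inter> W)) (u \<circ> chart_inv c)"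
  proof (rule smooth_on_cong[OF open_chart_image[OF ch W]])
    show "smooth_on (snd c ` (fst c \<inter> W)) (v \<circ> chart_inv c)"
      using v c by (simp add: smooth_fun_on_def)
  qed (use eq chart_inv_chart[OF ch] in auto)
qed

text \<open>The tensor \<open>R g\<close> does not change when \<open>g\<close> is scaled by a constant and \<open>Ric\<close> is kept. So the scalar curvature term
  can be written with the fixed metric \<open>g\<close> and the Ricci tensor of the conformal one.\<close>

lemma schouten_conformal:
  fixes g :: "('a, 'n::finite) tensor2"
  assumes G: "transpose (g c p) = g c p" "\<And>v. v \<noteq> 0 \<Longrightarrow> v \<bullet> (g c p *v v) > 0"
  shows "schouten \<tau> \<alpha> (conformal u g) c p = (\<alpha> / (real CARD('n) - 2)) *\<^sub>R
    (ricci (conformal u g) c p - (\<tau> * (\<Sum>j\<in>UNIV. \<Sum>k\<in>UNIV. matrix_inv (g c p) $ j $ k * ricci (conformal u g) c p $ j $ k)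
      / (2 * (real CARD('n) - 1))) *\<^sub>R g c p)"
proof -
  have "matrix_inv (conformal u g c p) = exp (- 2 * u p) *\<^sub>R matrix_inv (g c p)"
    unfolding conformal_def by (rule matrix_inv_exp_scaleR[OF positive_matrix_inverse(1)[OF G]])
  then have "scalar_curv (conformal u g) c p = exp (- 2 * u p) *
      (\<Sum>j\<in>UNIV. \<Sum>k\<in>UNIV. matrix_inv (g c p) $ j $ k * ricci (conformal u g) c p $ j $ k)"
    by (simp add: scalar_curv_def sum_distrib_left mult_ac)
  then have "(\<tau> * scalar_curv (conformal u g) c p / (2 * (real CARD('n) - 1))) *\<^sub>R conformal u g c p
      = ((exp (- 2 * u p) * exp (2 * u p)) * (\<tau> * (\<Sum>j\<in>UNIV. \<Sum>k\<in>UNIV. matrix_inv (g c p) $ j $ k * ricci (conformal u g) c p $ j $ k)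
      / (2 * (real CARD('n) - 1)))) *\<^sub>R g c p"
    by (simp add: conformal_def mult_ac)
  then show ?thesis by (simp add: schouten_def exp_add[symmetric])
qed

text \<open>Take the \<open>g\<close>-trace of the change \<open>-(n-2) W - tr(W) g\<close> of the Ricci tensor, which is \<open>-(2n-2) tr(W)\<close>, and insert
  both into the definition of the Schouten tensor.\<close>

lemma schouten_difference_at_critical_point:
  fixes g :: "('a::topological_space, 'n::finite) tensor2" and u v :: "'a \<Rightarrow> real"
  defines "w \<equiv> \<lambda>c y. u (chart_inv c y) - v (chart_inv c y)"
  assumes dim: "CARD('n) \<ge> 3" and c: "is_chart c" and p: "p \<in> fst c"
    and g: "local_metric S (g c \<circ> chart_inv c)" and S: "snd c p \<in> S"
    and u: "smooth_on S (u \<circ> chart_inv c)" and v: "smooth_on S (v \<circ> chart_inv c)"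
    and crit: "\<And>i. partial i (w c) (snd c p) = 0"
  defines "K \<equiv> \<chi> i j. partial i (partial j (w c)) (snd c p)"
  shows "transpose (schouten \<tau> \<alpha> (conformal u g) c p) = schouten \<tau> \<alpha> (conformal u g) c p"
    and "transpose (schouten \<tau> \<alpha> (conformal v g) c p) = schouten \<tau> \<alpha> (conformal v g) c p"
    and "schouten \<tau> \<alpha> (conformal u g) c p = schouten \<tau> \<alpha> (conformal v g) c p
      + \<alpha> *\<^sub>R (((\<tau> - 1) / (real CARD('n) - 2) * (\<Sum>i\<in>UNIV. \<Sum>j\<in>UNIV. matrix_inv (g c p) $ i $ j * K $ i $ j)) *\<^sub>R g c p - K)"
proof -
  let ?x = "snd c p"
  have gp: "(g c \<circ> chart_inv c) ?x = g c p" using chart_inv_chart[OF c p] by simp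
  interpret G: local_metric S "g c \<circ> chart_inv c" by fact
  have g_sym: "transpose (g c p) = g c p" using G.symmetric[OF S] unfolding gp .
  have g_pos: "\<And>z. z \<noteq> 0 \<Longrightarrow> z \<bullet> (g c p *v z) > 0" using G.positive[OF S] unfolding gp .
  define H where "H = (\<lambda>y. exp (2 * (v \<circ> chart_inv c) y) *\<^sub>R (g c \<circ> chart_inv c) y)"
  have Hm: "local_metric S H" unfolding H_def by (rule local_metric_conformal[OF g v])
  interpret H: local_metric S H by (rule Hm)
  have w: "smooth_on S (w c)"
    using smooth_on_diff[OF G.open_S u v] by (simp add: w_def)
  have confv: "conformal v g c \<circ> chart_inv c = H"
    by (simp add: fun_eq_iff H_def conformal_def)
  have confu: "conformal u g c \<circ> chart_inv c = (\<lambda>y. exp (2 * w c y) *\<^sub>R H y)"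
    by (simp add: fun_eq_iff H_def conformal_def w_def exp_add[symmetric])
  have confu': "conformal u g c \<circ> chart_inv c = (\<lambda>y. exp (2 * (u \<circ> chart_inv c) y) *\<^sub>R (g c \<circ> chart_inv c) y)"
    by (simp add: fun_eq_iff conformal_def)
  interpret E: local_metric S "conformal u g c \<circ> chart_inv c"
    unfolding confu' by (rule local_metric_conformal[OF g u])
  have ric_sym: "ricci (conformal u g) c p $ j $ k = ricci (conformal u g) c p $ k $ j"
    "ricci (conformal v g) c p $ j $ k = ricci (conformal v g) c p $ k $ j" for j k
    using E.ricci_sym[OF S] H.ricci_sym[OF S] by (simp_all add: ricci_def confv)
  have "schouten \<tau> \<alpha> (conformal u g) c p $ j $ k = schouten \<tau> \<alpha> (conformal u g) c p $ k $ j"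
    "schouten \<tau> \<alpha> (conformal v g) c p $ j $ k = schouten \<tau> \<alpha> (conformal v g) c p $ k $ j" for j k
    using ric_sym[of j k] symmetric_matrix_entry[OF g_sym, of j k]
    by (simp_all add: schouten_def conformal_def)
  then show "transpose (schouten \<tau> \<alpha> (conformal u g) c p) = schouten \<tau> \<alpha> (conformal u g) c p"
    "transpose (schouten \<tau> \<alpha> (conformal v g) c p) = schouten \<tau> \<alpha> (conformal v g) c p"
    by (simp_all add: vec_eq_iff transpose_def)
  let ?n = "real CARD('n)"
  let ?N = "\<lambda>i j. matrix_inv (g c p) $ i $ j"
  define t where "t = (\<Sum>i\<in>UNIV. \<Sum>j\<in>UNIV. ?N i j * K $ i $ j)"
  have trace_H: "(\<Sum>i\<in>UNIV. \<Sum>m\<in>UNIV. matrix_inv (H ?x) $ i $ m * K $ i $ m) * H ?x $ j $ k = t * g c p $ j $ k" for j k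
  proof -
    let ?e = "exp (2 * v p)"
    have Hx: "H ?x = ?e *\<^sub>R g c p" using chart_inv_chart[OF c p] by (simp add: H_def)
    have "matrix_inv (H ?x) = exp (- 2 * v p) *\<^sub>R matrix_inv (g c p)"
      unfolding Hx by (rule matrix_inv_exp_scaleR[OF positive_matrix_inverse(1)[OF g_sym g_pos]])
    then have "(\<Sum>i\<in>UNIV. \<Sum>m\<in>UNIV. matrix_inv (H ?x) $ i $ m * K $ i $ m) = exp (- 2 * v p) * t"
      by (simp add: t_def sum_distrib_left mult_ac)
    then have "(\<Sum>i\<in>UNIV. \<Sum>m\<in>UNIV. matrix_inv (H ?x) $ i $ m * K $ i $ m) * H ?x $ j $ k
        = (exp (- 2 * v p) * ?e) * (t * g c p $ j $ k)" by (simp add: Hx mult_ac)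
    then show ?thesis by (simp add: exp_add[symmetric])
  qed
  have ric: "ricci (conformal u g) c p $ j $ k = ricci (conformal v g) c p $ j $ k - (?n - 2) * K $ j $ k - t * g c p $ j $ k" for j k
    using H.ricci_conformal_at_critical_point[OF w S crit, of j k] trace_H[of j k]
    by (simp add: ricci_def confu confv K_def)
  have Ng: "(\<Sum>j\<in>UNIV. \<Sum>k\<in>UNIV. ?N j k * g c p $ j $ k) = ?n"
  proof -
    have "(\<Sum>k\<in>UNIV. ?N j k * g c p $ j $ k) = 1" for j
      using G.sum_N_H[OF S, of j j] symmetric_matrix_entry[OF g_sym, of j] unfolding gp by simp
    then show ?thesis by simp
  qed
  have tr: "(\<Sum>j\<in>UNIV. \<Sum>k\<in>UNIV. ?N j k * ricci (conformal u g) c p $ j $ k)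
      = (\<Sum>j\<in>UNIV. \<Sum>k\<in>UNIV. ?N j k * ricci (conformal v g) c p $ j $ k) - (?n - 2) * t - t * ?n"
  proof -
    have "(\<Sum>j\<in>UNIV. \<Sum>k\<in>UNIV. ?N j k * ricci (conformal u g) c p $ j $ k)
      = (\<Sum>j\<in>UNIV. \<Sum>k\<in>UNIV. ?N j k * ricci (conformal v g) c p $ j $ k
         - (?n - 2) * (?N j k * K $ j $ k) - t * (?N j k * g c p $ j $ k))"
      unfolding ric by (simp add: algebra_simps)
    also have "\<dots> = (\<Sum>j\<in>UNIV. \<Sum>k\<in>UNIV. ?N j k * ricci (conformal v g) c p $ j $ k)
        - (?n - 2) * t - t * (\<Sum>j\<in>UNIV. \<Sum>k\<in>UNIV. ?N j k * g c p $ j $ k)"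
      by (simp only: sum_subtractf sum_distrib_left[symmetric] t_def)
    finally show ?thesis unfolding Ng .
  qed
  have alg: "\<alpha> / (n - 2) * ((R - (n - 2) * k - t * h) - \<tau> * (s - (n - 2) * t - t * n) / (2 * (n - 1)) * h)
     = \<alpha> / (n - 2) * (R - \<tau> * s / (2 * (n - 1)) * h) + \<alpha> * ((\<tau> - 1) / (n - 2) * t * h - k)"
    if "n > 2" for n R k h s :: real
  proof -
    define X where "X = \<tau> * s / (2 * (n - 1))"
    have X: "\<tau> * (s - (n - 2) * t - t * n) / (2 * (n - 1)) = X - \<tau> * t"
      using that by (simp add: X_def field_simps)
    define m where "m = n - 2"
    have "m > 0" using that by (simp add: m_def)
    have "\<alpha> / m * ((R - m * k - t * h) - (X - \<tau> * t) * h)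
        = \<alpha> / m * (R - X * h) + \<alpha> * ((\<tau> - 1) / m * t * h - k)"
      using \<open>m > 0\<close> by (simp add: field_simps)
    then show ?thesis unfolding X X_def[symmetric] m_def .
  qed
  have "?n > 2" using dim by linarith
  note alg = alg[OF this]
  have expand: "schouten \<tau> \<alpha> (conformal z g) c p = (\<alpha> / (?n - 2)) *\<^sub>R
      (ricci (conformal z g) c p - (\<tau> * (\<Sum>j\<in>UNIV. \<Sum>k\<in>UNIV. ?N j k * ricci (conformal z g) c p $ j $ k)
        / (2 * (?n - 1))) *\<^sub>R g c p)" for z
    by (rule schouten_conformal) (use g_sym g_pos in auto)
  have "schouten \<tau> \<alpha> (conformal u g) c p $ j $ k = (schouten \<tau> \<alpha> (conformal v g) c p
      + \<alpha> *\<^sub>R (((\<tau> - 1) / (?n - 2) * t) *\<^sub>R g c p - K)) $ j $ k" for j k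
    unfolding expand unfolding tr unfolding vector_add_component vector_minus_component vector_scaleR_component
      real_scaleR_def ric by (rule alg)
  then show "schouten \<tau> \<alpha> (conformal u g) c p = schouten \<tau> \<alpha> (conformal v g) c p
      + \<alpha> *\<^sub>R (((\<tau> - 1) / (?n - 2) * (\<Sum>i\<in>UNIV. \<Sum>j\<in>UNIV. ?N i j * K $ i $ j)) *\<^sub>R g c p - K)"
    unfolding vec_eq_iff t_def by blast
qed

section \<open>Comparison at a touching point and on the whole domain\<close>

text \<open>The function \<open>u\<close> touches \<open>v\<close> from above at \<open>p\<close>, up to an additive constant. In the chart used to define the
  eigenvalues the difference has zero gradient and nonnegative Hessian \<open>K\<close> at \<open>p\<close>, and the eigenvalue comparison applies in an
  orthonormal frame diagonalizing the tensor of \<open>u\<close>.\<close>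

lemma comparison_at_touching_point:
  fixes \<A> :: "('a::t2_space, 'n::{finite,linorder}) chart set"
    and g :: "('a, 'n) tensor2" and \<Gamma> :: "(real^'n::{finite,linorder}) set"
  assumes dim: "CARD('n) \<ge> 3" and manifold: "smooth_atlas \<A>" and metric: "riemannian_metric \<A> g"
    and cone: "symmetric_cone \<Gamma>" and fcn: "curvature_function \<Gamma> f"
    and theta: "ellipticity_constant \<Gamma> \<theta>"
    and alpha: "\<alpha> = 1 \<or> \<alpha> = -1" and tau_neg: "\<alpha> = -1 \<Longrightarrow> \<tau> < 1"
    and tau_pos: "\<alpha> = 1 \<Longrightarrow> \<tau> > 1 + (real CARD('n) - 2) * (1 - real (kappa \<Gamma>) * \<theta>)"
    and u: "smooth_fun_on \<A> V u" and v: "smooth_fun_on \<A> V v" and p: "p \<in> V"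
    and min: "\<And>q. q \<in> V \<Longrightarrow> u p - v p \<le> u q - v q"
    and adm_u: "eigvals_at \<A> g (schouten \<tau> \<alpha> (conformal u g)) p \<in> \<Gamma>"
    and adm_v: "eigvals_at \<A> (conformal v g) (schouten \<tau> \<alpha> (conformal v g)) p \<in> \<Gamma>"
  shows "f (eigvals_at \<A> g (schouten \<tau> \<alpha> (conformal v g)) p)
    \<le> f (eigvals_at \<A> g (schouten \<tau> \<alpha> (conformal u g)) p)"
proof -
  have ec: "elliptic_concave \<Gamma> f" using fcn by (simp add: curvature_function_def)
  define c where "c = chart_at \<A> p"
  have "\<exists>c. c \<in> \<A> \<and> p \<in> fst c" using manifold unfolding smooth_atlas_def by blast
  then have c: "c \<in> \<A>" "p \<in> fst c"
    unfolding c_def chart_at_def by (metis (mono_tags, lifting) someI_ex)+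
  have ch: "is_chart c" using manifold c(1) by (simp add: smooth_atlas_def)
  have V: "open V" using u by (simp add: smooth_fun_on_def)
  define S where "S = snd c ` (fst c \<inter> V)"
  have S: "open S" "snd c p \<in> S" using open_chart_image[OF ch V] c p by (auto simp: S_def)
  have uS: "smooth_on S (u \<circ> chart_inv c)" and vS: "smooth_on S (v \<circ> chart_inv c)"
    using u v c(1) by (auto simp: smooth_fun_on_def S_def)
  have g_pt: "transpose (g c q) = g c q" "\<And>z. z \<noteq> 0 \<Longrightarrow> z \<bullet> (g c q *v z) > 0" if "q \<in> fst c" for q
    using metric c(1) that by (auto simp: riemannian_metric_def)
  have gS: "local_metric S (g c \<circ> chart_inv c)"
  proof
    show "smooth_on S (\<lambda>y. (g c \<circ> chart_inv c) y $ i $ j)" for i j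
    proof -
      have "smooth_fun_on {c} (fst c) (\<lambda>p. g c p $ i $ j)"
        using metric c(1) by (auto simp: riemannian_metric_def)
      then have "smooth_on (snd c ` fst c) ((\<lambda>p. g c p $ i $ j) \<circ> chart_inv c)"
        by (simp add: smooth_fun_on_def)
      then have "smooth_on S ((\<lambda>p. g c p $ i $ j) \<circ> chart_inv c)"
        by (rule smooth_on_subset) (auto simp: S_def)
      then show ?thesis by (simp add: comp_def)
    qed
    fix y assume "y \<in> S"
    then have "chart_inv c y \<in> fst c" using chart_inv_chart[OF ch] by (auto simp: S_def)
    then show "transpose ((g c \<circ> chart_inv c) y) = (g c \<circ> chart_inv c) y"
      "z \<noteq> 0 \<Longrightarrow> z \<bullet> ((g c \<circ> chart_inv c) y *v z) > 0" for z
      using g_pt by auto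
  qed (rule S(1))

  let ?w = "\<lambda>y. u (chart_inv c y) - v (chart_inv c y)"
  have w: "smooth_on S ?w" using smooth_on_diff[OF S(1) uS vS] by simp
  have wmin: "?w (snd c p) \<le> ?w y" if "y \<in> S" for y
    using that min chart_inv_chart[OF ch] c(2) by (auto simp: S_def)
  have crit: "partial i ?w (snd c p) = 0" for i
    by (rule second_derivative_test(1)[OF w S]) (rule wmin)
  have psd: "0 \<le> (\<Sum>i\<in>UNIV. \<Sum>j\<in>UNIV. z $ i * z $ j * partial i (partial j ?w) (snd c p))" for z
    by (rule second_derivative_test(2)[OF w S]) (rule wmin)
  define K where "K = (\<chi> i j. partial i (partial j ?w) (snd c p))"
  define Tu where "Tu = schouten \<tau> \<alpha> (conformal u g) c p"
  define Tv where "Tv = schouten \<tau> \<alpha> (conformal v g) c p"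
  note diff = schouten_difference_at_critical_point[where u = u and v = v and c = c and p = p and g = g and S = S, OF dim ch c(2) gS S(2) uS vS crit,
      where \<alpha> = \<alpha> and \<tau> = \<tau>, folded Tu_def Tv_def K_def]
  let ?t = "\<Sum>i\<in>UNIV. \<Sum>j\<in>UNIV. matrix_inv (g c p) $ i $ j * K $ i $ j"

  obtain Q :: "real^'n::{finite,linorder}^'n::{finite,linorder}" and b where Q: "transpose Q ** g c p ** Q = mat 1" "transpose Q ** Tu ** Q = diagonal b"
    using simultaneous_diagonalization[OF g_pt[OF c(2)] diff(1)] by blast
  obtain Q' :: "real^'n::{finite,linorder}^'n::{finite,linorder}" and l where Q': "transpose Q' ** g c p ** Q' = mat 1" "transpose Q' ** Tv ** Q' = diagonal l"
    using simultaneous_diagonalization[OF g_pt[OF c(2)] diff(2)] by blast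
  obtain P :: "'n \<Rightarrow> 'n \<Rightarrow> real" where P: "\<And>i j. P i j \<ge> 0" "\<And>i. (\<Sum>j\<in>UNIV. P i j) = 1"
    "\<And>j. (\<Sum>i\<in>UNIV. P i j) = 1"
    "\<And>i. (transpose Q ** Tv ** Q) $ i $ i = (\<Sum>j\<in>UNIV. P i j * l $ j)"
    by (rule diagonal_in_other_frame[OF Q(1) Q']) (rule that)

  obtain \<pi> where \<pi>: "bij \<pi>" "eigvals (matrix_inv (g c p) ** Tu) = (\<chi> i. b $ \<pi> i)"
    using eigvals_pencil[OF Q] by blast
  have b: "b \<in> \<Gamma>" "f (eigvals_at \<A> g (schouten \<tau> \<alpha> (conformal u g)) p) = f b"
    using permuted_in_coneD[OF cone ec \<pi>(1), of b] adm_u \<pi>(2)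
    by (simp_all add: eigvals_at_def Let_def c_def Tu_def)
  obtain \<rho> where \<rho>: "bij \<rho>" "eigvals (matrix_inv (g c p) ** Tv) = (\<chi> i. l $ \<rho> i)"
    using eigvals_pencil[OF Q'] by blast
  \<comment> \<open>The admissibility of \<open>v\<close> is stated relative to \<open>e\<^bsup>2v\<^esup> g\<close>, whose orthonormal frame is
    \<open>e\<^bsup>-v\<^esup> Q'\<close>; the eigenvalues differ by a positive factor, which the cone absorbs.\<close>
  have l: "l \<in> \<Gamma>"
  proof -
    let ?e = "exp (- v p)"
    have "transpose (?e *\<^sub>R Q') ** conformal v g c p ** (?e *\<^sub>R Q')
        = (?e * exp (2 * v p) * ?e) *\<^sub>R (transpose Q' ** g c p ** Q')"
      by (simp add: conformal_def vec_eq_iff matrix_matrix_mult_def transpose_def sum_distrib_left sum_distrib_right mult_ac)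
    also have "\<dots> = mat 1" unfolding Q'(1) by (simp add: exp_add[symmetric])
    finally have 1: "transpose (?e *\<^sub>R Q') ** conformal v g c p ** (?e *\<^sub>R Q') = mat 1" .
    have "transpose (?e *\<^sub>R Q') ** Tv ** (?e *\<^sub>R Q') = (?e * ?e) *\<^sub>R (transpose Q' ** Tv ** Q')"
      by (simp add: vec_eq_iff matrix_matrix_mult_def transpose_def sum_distrib_left sum_distrib_right mult_ac)
    also have "\<dots> = diagonal ((?e * ?e) *\<^sub>R l)"
      unfolding Q'(2) by (simp add: diagonal_def vec_eq_iff)
    finally obtain \<sigma> where \<sigma>: "bij \<sigma>"
        "eigvals (matrix_inv (conformal v g c p) ** Tv) = (\<chi> i. ((?e * ?e) *\<^sub>R l) $ \<sigma> i)"
      using eigvals_pencil[OF 1] by blast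
    have "(?e * ?e) *\<^sub>R l \<in> \<Gamma>"
      using permuted_in_coneD(1)[OF cone ec \<sigma>(1), of "(?e * ?e) *\<^sub>R l"] adm_v \<sigma>(2)
      by (simp add: eigvals_at_def Let_def c_def Tv_def)
    then have "(1 / (?e * ?e)) *\<^sub>R ((?e * ?e) *\<^sub>R l) \<in> \<Gamma>"
      using cone unfolding symmetric_cone_def by (meson divide_pos_pos exp_gt_zero mult_pos_pos zero_less_one)
    then show ?thesis by simp
  qed
  have fl: "f (eigvals_at \<A> g (schouten \<tau> \<alpha> (conformal v g)) p) = f l"
    using permuted_in_cone(2)[OF cone ec l \<rho>(1)] \<rho>(2)
    by (simp add: eigvals_at_def Let_def c_def Tv_def)

  define \<omega> where "\<omega> i = (transpose Q ** K ** Q) $ i $ i" for i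
  have nonneg: "\<omega> i \<ge> 0" for i
    using psd[of "column i Q"]
    by (simp add: \<omega>_def congruence_diagonal_entry K_def column_def)
  have "b $ i = (\<Sum>j\<in>UNIV. P i j * l $ j)
      + \<alpha> * ((\<tau> - 1) / (real CARD('n) - 2) * (\<Sum>j\<in>UNIV. \<omega> j) - \<omega> i)" for i
  proof -
    define s where "s = (\<tau> - 1) / (real CARD('n) - 2) * ?t"
    have "b $ i = (transpose Q ** Tu ** Q) $ i $ i" by (simp add: Q(2) diagonal_def)
    also have "\<dots> = (transpose Q ** Tv ** Q) $ i $ i
        + \<alpha> * (s * (transpose Q ** g c p ** Q) $ i $ i - (transpose Q ** K ** Q) $ i $ i)"
      unfolding diff(3) s_def[symmetric]
      by (simp add: congruence_diagonal_entry algebra_simps sum.distrib sum_subtractf sum_distrib_left)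
    also have "s = (\<tau> - 1) / (real CARD('n) - 2) * (\<Sum>j\<in>UNIV. \<omega> j)"
      unfolding s_def congruence_trace[OF Q(1)] \<omega>_def ..
    finally show ?thesis by (simp add: P(4) Q(1) mat_def \<omega>_def)
  qed
  from comparison_of_eigenvalues[OF dim cone fcn theta alpha tau_neg tau_pos b(1) l P(1-3) nonneg this]
  show ?thesis unfolding fl b(2) by simp
qed

theorem theorem4p3:
  fixes \<A> :: "('a::{t2_space, second_countable_topology}, 'n::{finite,linorder}) chart set"
    and g :: "('a, 'n) tensor2"
    and \<psi> ubar :: "'a \<Rightarrow> real"
    and \<Gamma> :: "(real^'n::{finite,linorder}) set"
    and f :: "real^'n::{finite,linorder} \<Rightarrow> real"
    and \<theta> \<tau> \<alpha> \<Lambda>\<^sub>1 :: real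
    and M :: "nat \<Rightarrow> 'a set"
    and u :: "nat \<Rightarrow> 'a \<Rightarrow> real"
  assumes dim: "CARD('n) \<ge> 3"
    and manifold: "smooth_atlas \<A>"
    and metric: "riemannian_metric \<A> g"
    and complete: "complete_metric \<A> g"
    and noncompact: "\<not> compact (UNIV :: 'a set)"
    and psi: "smooth_fun_on \<A> UNIV \<psi>" "\<And>p. \<psi> p > 0"
    and cone: "symmetric_cone \<Gamma>"
    and fcn: "curvature_function \<Gamma> f"
    and theta: "ellipticity_constant \<Gamma> \<theta>"
    and alpha: "\<alpha> = 1 \<or> \<alpha> = -1"
    and tau_neg: "\<alpha> = -1 \<Longrightarrow> \<tau> < 1"
    and tau_pos: "\<alpha> = 1 \<Longrightarrow>
          \<tau> > 1 + (real CARD('n) - 2) * (1 - real (kappa \<Gamma>) * \<theta>)"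
    and ubar_smooth: "smooth_fun_on \<A> UNIV ubar"
    and ubar_complete: "complete_metric \<A> (conformal ubar g)"
    and ubar_admissible: "\<And>p. eigvals_at \<A> (conformal ubar g)
          (schouten \<tau> \<alpha> (conformal ubar g)) p \<in> \<Gamma>"
    and Lambda_pos: "\<Lambda>\<^sub>1 > 0"
    and ubar_sub: "\<And>p. f (eigvals_at \<A> g (schouten \<tau> \<alpha> (conformal ubar g)) p)
          \<ge> \<Lambda>\<^sub>1 * \<psi> p * exp (2 * ubar p)"
    and exhaustion: "(\<Union>k\<in>{1..}. M k) = UNIV"
      "\<And>k. k \<ge> 1 \<Longrightarrow> smooth_compact_domain \<A> (M k)"
      "\<And>k. k \<ge> 1 \<Longrightarrow> closure (M k) \<subseteq> M (Suc k)"
    and solution: "\<And>k. k \<ge> 1 \<Longrightarrow>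
          dirichlet_solution \<A> g \<tau> \<alpha> \<Gamma> f \<psi> (M k) ubar (u k)"
  shows "\<forall>k\<ge>1. \<forall>p\<in>M k. u k p \<ge> ubar p + 1/2 * min 0 (ln \<Lambda>\<^sub>1)"
proof (intro allI impI ballI)
  fix k p assume k: "k \<ge> 1" and p: "p \<in> M k"
  define D where "D = M k"
  have dom: "open D" "compact (closure D)"
    using exhaustion(2)[OF k] by (auto simp: smooth_compact_domain_def D_def)
  have sol: "smooth_up_to \<A> (closure D) (u k)" "admissible_on \<A> g \<tau> \<alpha> \<Gamma> (closure D) (u k)"
    "\<And>q. q \<in> D \<Longrightarrow> f (eigvals_at \<A> g (schouten \<tau> \<alpha> (conformal (u k) g)) q) = \<psi> q * exp (2 * u k q)"
    "\<And>q. q \<in> frontier D \<Longrightarrow> u k q = ubar q"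
    using solution[OF k] by (auto simp: dirichlet_solution_def D_def)
  have ext: "\<exists>W v. q \<in> W \<and> smooth_fun_on \<A> W v \<and> (\<forall>r\<in>W \<inter> closure D. v r = u k r)" if "q \<in> closure D" for q
    using sol(1) that unfolding smooth_up_to_def smooth_ext_at_def by blast
  have cont: "continuous_on (closure D) (u k)"
    unfolding continuous_on_eq_continuous_within
  proof
    fix q assume q: "q \<in> closure D"
    obtain W v where W: "q \<in> W" "smooth_fun_on \<A> W v" "\<forall>r\<in>W \<inter> closure D. v r = u k r"
      using ext[OF q] by (elim exE conjE)
    have "open W" using W(2) by (simp add: smooth_fun_on_def)
    have "continuous_on (W \<inter> closure D) v"
      using smooth_fun_on_continuous[OF manifold W(2)] by (rule continuous_on_subset) auto
    then have "continuous_on (closure D \<inter> W) (u k)"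
      by (subst Int_commute, rule continuous_on_eq) (rule W(3)[rule_format])
    then have "continuous (at q within closure D \<inter> W) (u k)"
      using q W(1) by (simp add: continuous_on_eq_continuous_within)
    then show "continuous (at q within closure D) (u k)"
      using at_within_nhd[OF W(1) \<open>open W\<close>, of "closure D" "closure D \<inter> W"]
      by (auto simp: continuous_within)
  qed
  have "continuous_on (closure D) ubar"
    using smooth_fun_on_continuous[OF manifold ubar_smooth] by (rule continuous_on_subset) auto
  with cont have "continuous_on (closure D) (\<lambda>q. u k q - ubar q)" by (rule continuous_on_diff)
  moreover have pD: "p \<in> closure D" using p closure_subset by (auto simp: D_def)
  ultimately have "\<exists>q\<in>closure D. \<forall>r\<in>closure D. u k q - ubar q \<le> u k r - ubar r"
    by (intro continuous_attains_inf[OF dom(2)]) auto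
  then obtain q where q: "q \<in> closure D"
    and min: "\<And>r. r \<in> closure D \<Longrightarrow> u k q - ubar q \<le> u k r - ubar r"
    by (elim bexE) simp
  have "u k q - ubar q \<ge> 1/2 * min 0 (ln \<Lambda>\<^sub>1)"
  proof (cases "q \<in> D")
    case False
    then have "q \<in> frontier D" using q dom(1) by (simp add: frontier_def interior_open)
    then show ?thesis using sol(4) by simp
  next
    case True
    obtain W v where W: "q \<in> W" "smooth_fun_on \<A> W v" "\<forall>r\<in>W \<inter> closure D. v r = u k r"
      using ext[OF q] by (elim exE conjE)
    let ?V = "W \<inter> D"
    have V: "open ?V" using W(2) dom(1) by (auto simp: smooth_fun_on_def)
    have subV: "?V \<subseteq> W \<inter> closure D" using closure_subset by blast
    have uV: "smooth_fun_on \<A> ?V (u k)"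
      by (rule smooth_fun_on_cong[OF manifold smooth_fun_on_subset[OF W(2) V]]) (use W(3) subV in auto)
    have bV: "smooth_fun_on \<A> ?V ubar"
      by (rule smooth_fun_on_subset[OF ubar_smooth V]) simp
    \<comment> \<open>At an interior point \<open>u k\<close> is its own smooth extension.\<close>
    have "smooth_ext_at \<A> (closure D) q (u k) (u k)"
      unfolding smooth_ext_at_def using uV W(1) True by blast
    then have adm: "eigvals_at \<A> g (schouten \<tau> \<alpha> (conformal (u k) g)) q \<in> \<Gamma>"
      using sol(2) q unfolding admissible_on_def by blast
    have "\<Lambda>\<^sub>1 * \<psi> q * exp (2 * ubar q) \<le> f (eigvals_at \<A> g (schouten \<tau> \<alpha> (conformal ubar g)) q)"
      by (rule ubar_sub)
    also have "\<dots> \<le> f (eigvals_at \<A> g (schouten \<tau> \<alpha> (conformal (u k) g)) q)"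
      by (rule comparison_at_touching_point[OF dim manifold metric cone fcn theta alpha tau_neg tau_pos
            uV bV _ _ adm ubar_admissible]) (use W(1) True min subV in auto)
    also have "\<dots> = \<psi> q * exp (2 * u k q)" by (rule sol(3)[OF True])
    finally have "\<Lambda>\<^sub>1 * exp (2 * ubar q) \<le> exp (2 * u k q)"
      using psi(2)[of q] by (simp add: mult.assoc mult.left_commute[of _ "\<psi> q"])
    moreover have "\<Lambda>\<^sub>1 = exp (ln \<Lambda>\<^sub>1)" using Lambda_pos by simp
    ultimately have "exp (ln \<Lambda>\<^sub>1 + 2 * ubar q) \<le> exp (2 * u k q)" by (metis exp_add)
    then have "ln \<Lambda>\<^sub>1 + 2 * ubar q \<le> 2 * u k q" by simp
    then show ?thesis by (simp add: min_def)
  qed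
  also have "\<dots> \<le> u k p - ubar p" by (rule min[OF pD])
  finally show "u k p \<ge> ubar p + 1/2 * min 0 (ln \<Lambda>\<^sub>1)" by simp
qed

end
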